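(* Let $X$ be an Asplund space and $x\in L^\infty(T,X)$. Let $f\colon T\times X\to\mathbb{R}$ be a Lusin integrand for which there are $k\in L^1(T;\mathbb{R}_+)$ and $\epsilon>0$ such that $$|f_t(u)-f_t(v)|\le k(t)\|u-v\|\quad\text{for all }u,v\in\mathbb{B}_\epsilon(x(t)),\text{ for all }t\in T,$$ and consider $\mathcal{I}_f(y)=\int_Tf_t(y(t))\,d\mu$ on $L^\infty(T,X)$. Assume, in addition, that $(t,v)\mapsto df_t(x(t))(v)$ is a Lusin integrand. Then $$d\mathcal{I}_f(x)(v)\le\int_T df_t(x(t))(v(t))\,d\mu\quad\text{for all }v\in L^\infty(T,X).$$ Moreover, $$\overline{\partial}\mathcal{I}_f(x)\subset\{x^\ast\in L^1(T,X^\ast): x^\ast(t)\in\overline{\partial}f_t(x(t))\ \ \mu\text{-a.e.}\}.$$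
   Context: Standing assumptions: $X$ is a (not necessarily separable) Banach space with dual $X^\ast$, $(T,d)$ is a metric space, and $(T,\mathcal{A},\mu)$ is a complete $\sigma$-finite measure space with $\mathcal{A}$ containing the Borel $\sigma$-algebra of $T$; $\mu$ is inner regular, meaning that for all $\varepsilon>0$ and $B\in\mathcal{A}$ of finite measure there is a compact $K\subset B$ with $\mu(B\setminus K)<\varepsilon$. Notation: $f_t(x):=f(t,x)$; $\operatorname{epi} f_t:=\{(x,\alpha)\in X\times\mathbb{R}: f_t(x)\le\alpha\}$; $\mathbb{B}_\epsilon(z)$ is the closed ball. Elements $x^\ast\in L^1(T,X^\ast)$ are regarded as elements of $L^\infty(T,X)^\ast$ via $y\mapsto\int_T\langle x^\ast(t),y(t)\rangle\,d\mu$. For a real-valued function $g$ on a Banach space $Z$, locally Lipschitz around $z\in Z$: $dg(z)(v):=\limsup_{y\to z,\ s\to0^+}s^{-1}[g(y+sv)-g(y)]$ and $\overline{\partial}g(z):=\{z^\ast\in Z^\ast:\langle z^\ast,v\rangle\le dg(z)(v)\ \forall v\in Z\}$ is the Clarke subdifferential. A function $f\colon T\times X\to[-\infty,\infty]$ is a Lusin integrand if for every $\varepsilon>0$ and $A\in\mathcal{A}$ of finite measure there is a compact $B\subset A$ with $\mu(A\setminus B)<\varepsilon$ such that $B\ni t\rightrightarrows\operatorname{epi} f_t$ is lower semicontinuous, i.e. for every $t\in B$ and open $V\subset X\times\mathbb{R}$ with $\operatorname{epi} f_t\cap V\ne\emptyset$ there is a neighbourhood $U$ of $t$ in $B$ with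 $\operatorname{epi} f_s\cap V\ne\emptyset$ for all $s\in U$.
   Formalization: The integrability of t ↦ f_t(x(t)) is added as a hypothesis; without it I_f need not be finite near x (e.g. f_t ≡ 1 on the real line with Lebesgue measure), and dI_f(x) is then undefined. *)

theory Defs
  imports "HOL-Analysis.Analysis" "HOL-Probability.Essential_Supremum"
begin

text \<open>Every continuous convex function on an open convex set is Frechet differentiable on a dense
  subset of that set.\<close>

definition asplund_space :: "'x::banach itself \<Rightarrow> bool" where
  "asplund_space _ \<longleftrightarrow>
     (\<forall>(U :: 'x set) (g :: 'x \<Rightarrow> real).
        open U \<and> convex U \<and> convex_on U g \<and> continuous_on U g \<longrightarrow>
        U \<subseteq> closure {u \<in> U. g differentiable (at u)})"

definition inner_regular :: "'t::metric_space measure \<Rightarrow> bool" where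
  "inner_regular M \<longleftrightarrow>
     (\<forall>\<epsilon>>0. \<forall>B\<in>sets M. emeasure M B < \<infinity> \<longrightarrow>
        (\<exists>K. compact K \<and> K \<subseteq> B \<and> emeasure M (B - K) < ennreal \<epsilon>))"

definition epi :: "('x \<Rightarrow> ereal) \<Rightarrow> ('x \<times> real) set" where
  "epi g = {(u, \<alpha>). g u \<le> ereal \<alpha>}"

definition lsc_multifunction_on :: "'t::topological_space set \<Rightarrow> ('t \<Rightarrow> 'y::topological_space set) \<Rightarrow> bool" where
  "lsc_multifunction_on B F \<longleftrightarrow>
     (\<forall>t\<in>B. \<forall>V. open V \<and> F t \<inter> V \<noteq> {} \<longrightarrow>
        (\<exists>U. openin (top_of_set B) U \<and> t \<in> U \<and> (\<forall>s\<in>U. F s \<inter> V \<noteq> {})))"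

definition lusin_integrand ::
    "'t::metric_space measure \<Rightarrow> ('t \<Rightarrow> 'x::real_normed_vector \<Rightarrow> ereal) \<Rightarrow> bool" where
  "lusin_integrand M f \<longleftrightarrow>
     (\<forall>\<epsilon>>0. \<forall>A\<in>sets M. emeasure M A < \<infinity> \<longrightarrow>
        (\<exists>B. compact B \<and> B \<subseteq> A \<and> emeasure M (A - B) < ennreal \<epsilon> \<and>
             lsc_multifunction_on B (\<lambda>t. epi (f t))))"

text \<open>The library's Bochner integral requires a second countable codomain, so the Bochner-Lebesgue
  spaces of functions with values in a nonseparable space are introduced here. Their elements are
  functions rather than equivalence classes; only their almost-everywhere classes matter below.\<close>

definition strongly_measurable :: "'t measure \<Rightarrow> ('t \<Rightarrow> 'y::real_normed_vector) \<Rightarrow> bool" where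
  "strongly_measurable M y \<longleftrightarrow>
     (\<exists>s. (\<forall>i::nat. simple_function M (s i)) \<and> (AE t in M. (\<lambda>i. s i t) \<longlonglongrightarrow> y t))"

definition Lone :: "'t measure \<Rightarrow> ('t \<Rightarrow> 'y::real_normed_vector) set" where
  "Lone M = {y. strongly_measurable M y \<and> integrable M (\<lambda>t. norm (y t))}"

definition Linf :: "'t measure \<Rightarrow> ('t \<Rightarrow> 'y::real_normed_vector) set" where
  "Linf M = {y. strongly_measurable M y \<and> (\<exists>C::real. AE t in M. norm (y t) \<le> C)}"

definition Linf_norm :: "'t measure \<Rightarrow> ('t \<Rightarrow> 'y::real_normed_vector) \<Rightarrow> real" where
  "Linf_norm M y = enn2real (esssup M (\<lambda>t. ennreal (norm (y t))))"

definition Linf_nhds :: "'t measure \<Rightarrow> ('t \<Rightarrow> 'y::real_normed_vector) \<Rightarrow> ('t \<Rightarrow> 'y) filter" where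
  "Linf_nhds M z = (INF \<delta>\<in>{0<..}. principal {y \<in> Linf M. Linf_norm M (\<lambda>t. y t - z t) < \<delta>})"

text \<open>Functionals are made extensional, so that they are determined by their action on
  \<open>Linf M\<close>. Being bounded, they do not distinguish functions that agree almost everywhere.\<close>

definition Linf_dual :: "'t measure \<Rightarrow> (('t \<Rightarrow> 'y::real_normed_vector) \<Rightarrow> real) set" where
  "Linf_dual M = {\<phi> \<in> extensional (Linf M).
     (\<forall>y\<in>Linf M. \<forall>z\<in>Linf M. \<phi> (\<lambda>t. y t + z t) = \<phi> y + \<phi> z) \<and>
     (\<forall>c. \<forall>y\<in>Linf M. \<phi> (\<lambda>t. c *\<^sub>R y t) = c * \<phi> y) \<and>
     (\<exists>C. \<forall>y\<in>Linf M. \<bar>\<phi> y\<bar> \<le> C * Linf_norm M y)}"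

definition Lone_functional ::
    "'t measure \<Rightarrow> ('t \<Rightarrow> 'y::real_normed_vector \<Rightarrow>\<^sub>L real) \<Rightarrow> ('t \<Rightarrow> 'y) \<Rightarrow> real" where
  "Lone_functional M \<xi> = restrict (\<lambda>y. \<integral>t. blinfun_apply (\<xi> t) (y t) \<partial>M) (Linf M)"

definition integral_functional :: "'t measure \<Rightarrow> ('t \<Rightarrow> 'x \<Rightarrow> real) \<Rightarrow> ('t \<Rightarrow> 'x) \<Rightarrow> real" where
  "integral_functional M f y = (\<integral>t. f t (y t) \<partial>M)"

text \<open>The Clarke directional derivative and subdifferential, for functions on a normed space and
  for functions on \<open>Linf M\<close>.\<close>

definition clarke_dd :: "('x::real_normed_vector \<Rightarrow> real) \<Rightarrow> 'x \<Rightarrow> 'x \<Rightarrow> ereal" where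
  "clarke_dd g z v =
     Limsup (nhds z \<times>\<^sub>F at_right 0) (\<lambda>(y, s). ereal ((g (y + s *\<^sub>R v) - g y) / s))"

definition clarke_subdiff :: "('x::real_normed_vector \<Rightarrow> real) \<Rightarrow> 'x \<Rightarrow> ('x \<Rightarrow>\<^sub>L real) set" where
  "clarke_subdiff g z = {\<zeta>. \<forall>v. ereal (blinfun_apply \<zeta> v) \<le> clarke_dd g z v}"

definition Linf_clarke_dd ::
    "'t measure \<Rightarrow> (('t \<Rightarrow> 'x::real_normed_vector) \<Rightarrow> real) \<Rightarrow> ('t \<Rightarrow> 'x) \<Rightarrow> ('t \<Rightarrow> 'x) \<Rightarrow> ereal" where
  "Linf_clarke_dd M G z v =
     Limsup (Linf_nhds M z \<times>\<^sub>F at_right 0) (\<lambda>(y, s). ereal ((G (\<lambda>t. y t + s *\<^sub>R v t) - G y) / s))"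

definition Linf_clarke_subdiff ::
    "'t measure \<Rightarrow> (('t \<Rightarrow> 'x::real_normed_vector) \<Rightarrow> real) \<Rightarrow> ('t \<Rightarrow> 'x) \<Rightarrow> (('t \<Rightarrow> 'x) \<Rightarrow> real) set" where
  "Linf_clarke_subdiff M G z =
     {\<phi> \<in> Linf_dual M. \<forall>v\<in>Linf M. ereal (\<phi> v) \<le> Linf_clarke_dd M G z v}"

end

theory Submission
  imports Defs
begin

text \<open>Write \<open>h t u\<close> for the Clarke derivative of \<open>f t\<close> at \<open>x t\<close> in direction \<open>u\<close>. The Lipschitz
  condition makes \<open>h t\<close> real valued, \<open>k t\<close>-Lipschitz and bounded by \<open>k t * norm u\<close>.

  The inequality for the directional derivative is a reverse Fatou argument. If it fails, there are
  \<open>y\<^sub>n\<close> tending to \<open>x\<close> in the supremum norm and positive \<open>s\<^sub>n\<close> tending to \<open>0\<close> whose difference quotients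
  \<open>q\<^sub>n\<close> have integrals above some \<open>c\<close> larger than the integral of \<open>h t (v t)\<close>. The \<open>q\<^sub>n\<close> are
  dominated by a multiple of \<open>k\<close>, and the positive parts of \<open>q\<^sub>n - h\<close> tend to zero pointwise, so
  dominated convergence gives a contradiction. Measurability of all integrands comes from the Lusin
  condition: on large compact sets on which \<open>x\<close>, \<open>y\<close> are continuous and \<open>k\<close> is bounded, lower
  semicontinuity of the epigraphs together with the Lipschitz bound makes \<open>t \<mapsto> f t (y t)\<close> upper
  semicontinuous (\<open>lsc_epigraph_imp_usc\<close>, \<open>superposition_measurable\<close>).

  A subgradient \<open>\<phi>\<close> of the integral functional then satisfies \<open>\<phi> v \<le> \<integral> h t (v t)\<close>, hence
  \<open>\<bar>\<phi> v\<bar> \<le> \<integral> k t * norm (v t)\<close>. So \<open>A \<mapsto> \<phi> (1\<^sub>A \<cdot>)\<close> is a vector measure with values in the dual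
  space and variation dominated by the finite measure with density \<open>k\<close>. The dual of an Asplund space
  has the Radon-Nikodym property, which produces the density of this measure
  (\<open>asplund_dual_Radon_Nikodym\<close>). The reason is that the support function of a bounded set of
  functionals is convex and continuous, hence Frechet differentiable somewhere, and there the set has
  a slice of small diameter (\<open>asplund_small_slice\<close>). Applied to the set of averages of the vector
  measure, this yields sets of positive measure on which the averages hardly vary; an exhaustion
  argument splits the space into countably many such sets, and the step functions formed with the
  corresponding averages converge to the density.

  It remains to see that the density \<open>\<xi>\<close> is almost everywhere a Clarke subgradient. For each fixed
  direction \<open>u\<close> the inequality \<open>\<xi> t u \<le> h t u\<close> holds almost everywhere, but the exceptional set
  depends on \<open>u\<close>, and there are uncountably many directions, without a countable dense subset in
  general. On a compact set on which \<open>\<xi>\<close> is continuous and \<open>h\<close> upper semicontinuous, a violation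
  at one point persists, in the same direction, on a relatively open neighbourhood, which is
  therefore null; by inner regularity the union of all these null neighbourhoods is null
  (\<open>null_open_cover\<close>, \<open>AE_all_directions\<close>).\<close>

section \<open>The Radon-Nikodym property of duals of Asplund spaces\<close>

text \<open>If \<open>L\<close> is the Frechet derivative of the support function \<open>p\<close> of \<open>S\<close> at \<open>u\<close>, then every \<open>a\<close> in
  \<open>S\<close> that almost attains \<open>p u\<close> satisfies \<open>a w = a (u + w) - a u \<le> p (u + w) - a u\<close>, which is at
  most \<open>L w\<close> up to a small multiple of \<open>norm w\<close> on a sphere around \<open>0\<close>; so \<open>a\<close> is close to \<open>L\<close>
  in norm. This is the easy half of Smulian's criterion.\<close>

lemma asplund_small_slice:
  fixes S :: "('x::banach \<Rightarrow>\<^sub>L real) set"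
  assumes asp: "asplund_space TYPE('x)" and S: "bounded S" "S \<noteq> {}" and e: "e > 0"
  obtains u c L where "\<exists>a\<in>S. blinfun_apply a u > c"
    and "\<And>a. a \<in> S \<Longrightarrow> blinfun_apply a u > c \<Longrightarrow> norm (a - L) \<le> e"
proof -
  obtain K where K: "\<And>a. a \<in> S \<Longrightarrow> norm a \<le> K"
    using S(1) by (auto simp: bounded_iff)
  define p where "p = (\<lambda>u::'x. SUP a\<in>S. blinfun_apply a u)"
  have aK: "\<bar>blinfun_apply a u\<bar> \<le> K * norm u" if "a \<in> S" for a u
    using norm_blinfun[of a u] K[OF that] mult_right_mono[OF K[OF that] norm_ge_zero[of u]] by simp
  have bdd: "bdd_above ((\<lambda>a. blinfun_apply a u) ` S)" for u
    using aK[of _ u] by (intro bdd_aboveI[of _ "K * norm u"]) (auto simp: abs_le_iff)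
  have le_p: "blinfun_apply a u \<le> p u" if "a \<in> S" for a u
    unfolding p_def by (intro cSUP_upper that bdd)
  have p_le: "p u \<le> r" if "\<And>a. a \<in> S \<Longrightarrow> blinfun_apply a u \<le> r" for u r
    unfolding p_def by (intro cSUP_least S that)
  have conv: "convex_on UNIV p"
  proof (rule convex_onI)
    fix t :: real and y z :: 'x
    assume t: "0 < t" "t < 1"
    show "p ((1 - t) *\<^sub>R y + t *\<^sub>R z) \<le> (1 - t) * p y + t * p z"
    proof (rule p_le)
      fix a assume a: "a \<in> S"
      have "(1 - t) * blinfun_apply a y \<le> (1 - t) * p y" "t * blinfun_apply a z \<le> t * p z"
        using t le_p[OF a] by (auto intro!: mult_left_mono)
      then show "blinfun_apply a ((1 - t) *\<^sub>R y + t *\<^sub>R z) \<le> (1 - t) * p y + t * p z"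
        by (simp add: blinfun.add_right blinfun.scaleR_right)
    qed
  qed simp
  have lip: "p y \<le> p z + K * norm (y - z)" for y z
  proof (rule p_le)
    fix a assume a: "a \<in> S"
    have "blinfun_apply a y = blinfun_apply a z + blinfun_apply a (y - z)"
      by (simp add: blinfun.diff_right)
    then show "blinfun_apply a y \<le> p z + K * norm (y - z)"
      using le_p[OF a, of z] aK[OF a, of "y - z"] by linarith
  qed
  obtain a0 where "a0 \<in> S" using S(2) by blast
  then have "0 \<le> K" using K norm_ge_zero order_trans by blast
  have "K-lipschitz_on UNIV p"
  proof (rule lipschitz_onI)
    fix y z
    show "dist (p y) (p z) \<le> K * dist y z"
      using lip[of y z] lip[of z y] by (simp add: dist_norm norm_minus_commute abs_le_iff)
  qed fact
  then have cont: "continuous_on UNIV p" by (rule lipschitz_on_continuous_on)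
  have "UNIV \<subseteq> closure {u \<in> UNIV. p differentiable (at u)}"
    using asp conv cont unfolding asplund_space_def by (metis open_UNIV convex_UNIV)
  then have "{u \<in> UNIV. p differentiable (at u)} \<noteq> {}"
    by (metis closure_empty UNIV_not_empty subset_empty)
  then obtain u L' where L': "(p has_derivative L') (at u)"
    unfolding differentiable_def by auto
  then have bl: "bounded_linear L'" by (rule has_derivative_bounded_linear)
  define L where "L = Blinfun L'"
  have L[simp]: "blinfun_apply L = L'"
    unfolding L_def by (rule bounded_linear_Blinfun_apply[OF bl])
  obtain d where d: "d > 0"
    "\<And>y. norm (y - u) < d \<Longrightarrow> norm (p y - p u - L' (y - u)) \<le> e/2 * norm (y - u)"
    using L' e unfolding has_derivative_at_alt by (meson half_gt_zero)
  define r where "r = d/2"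
  have r: "r > 0" "r < d" using d by (auto simp: r_def)
  \<comment> \<open>The depth of the slice matches the error \<open>e/2 * r\<close> of the linearisation on the sphere of radius \<open>r\<close>.\<close>
  define c where "c = p u - e/2 * r"
  have "c < p u" using e r by (simp add: c_def)
  then have 1: "\<exists>a\<in>S. blinfun_apply a u > c"
    using p_le[of u c] by (meson not_less)
  have 2: "norm (a - L) \<le> e" if a: "a \<in> S" "blinfun_apply a u > c" for a
  proof -
    have *: "blinfun_apply (a - L) h \<le> e * r" if h: "norm h = r" for h
    proof -
      have "p (u + h) - p u - L' h \<le> e/2 * r"
        using d(2)[of "u + h"] h r abs_ge_self[of "p (u + h) - p u - L' h"] by simp
      moreover have "blinfun_apply a h = blinfun_apply a (u + h) - blinfun_apply a u"
        by (simp add: blinfun.add_right)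
      ultimately show ?thesis
        using le_p[OF a(1), of "u + h"] a(2) by (simp add: blinfun.diff_left c_def)
    qed
    have **: "blinfun_apply (a - L) w \<le> e * norm w" for w
    proof (cases "w = 0")
      case False
      have "blinfun_apply (a - L) ((r / norm w) *\<^sub>R w) \<le> e * r"
        using r False by (intro *) simp
      then show ?thesis using r False
        by (simp add: blinfun.scaleR_right divide_simps mult.commute mult.left_commute)
    qed simp
    show ?thesis
    proof (rule norm_blinfun_bound)
      show "norm (blinfun_apply (a - L) w) \<le> e * norm w" for w
        using **[of w] **[of "- w"] by (simp add: blinfun.minus_right abs_le_iff)
    qed (use e in simp)
  qed
  show thesis using that[OF 1 2] .
qed

text \<open>Greedy choice: among the members of \<open>\<P>\<close> inside what is left, always remove one whose measure is
  at least half of the supremum. The measures of the removed sets are summable and hence tend to zero,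
  so nothing of positive measure can be left over.\<close>

lemma (in finite_measure) exhaustion:
  assumes C: "C \<in> sets M" and P: "\<P> \<subseteq> sets M" "{} \<in> \<P>"
    and step: "\<And>E. E \<in> sets M \<Longrightarrow> E \<subseteq> C \<Longrightarrow> 0 < measure M E \<Longrightarrow> \<exists>D\<in>\<P>. D \<subseteq> E \<and> 0 < measure M D"
  obtains D :: "nat \<Rightarrow> 'a set" where "disjoint_family D" "\<And>n. D n \<in> \<P>" "\<And>n. D n \<subseteq> C"
    "measure M (C - (\<Union>n. D n)) = 0"
proof -
  \<comment> \<open>The greedy step; when the supremum is zero, the empty set will do.\<close>
  have "\<exists>D\<in>\<P>. D \<subseteq> C - U \<and> (\<forall>D'\<in>\<P>. D' \<subseteq> C - U \<longrightarrow> measure M D' \<le> 2 * measure M D)" for U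
  proof -
    let ?F = "{D \<in> \<P>. D \<subseteq> C - U}"
    let ?s = "Sup (measure M ` ?F)"
    have bdd: "bdd_above (measure M ` ?F)"
      using P by (intro bdd_aboveI[of _ "measure M (space M)"]) (auto intro: bounded_measure)
    have ne: "measure M ` ?F \<noteq> {}" using P by auto
    have le: "measure M D' \<le> ?s" if "D' \<in> ?F" for D'
      using bdd that by (intro cSup_upper) auto
    show ?thesis
    proof (cases "?s > 0")
      case True
      then have "?s / 2 < ?s" by simp
      then obtain D where "D \<in> ?F" "?s / 2 < measure M D"
        using less_cSup_iff[OF ne bdd] by blast
      then show ?thesis using le by (intro bexI[of _ D]) force+
    next
      case False
      then show ?thesis using le P by (intro bexI[of _ "{}"]) force+
    qed
  qed
  then obtain G where G: "\<And>U. G U \<in> \<P>" "\<And>U. G U \<subseteq> C - U"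
    "\<And>U D'. D' \<in> \<P> \<Longrightarrow> D' \<subseteq> C - U \<Longrightarrow> measure M D' \<le> 2 * measure M (G U)"
    by metis
  define U where "U = rec_nat {} (\<lambda>_ U. U \<union> G U)"
  define D where "D n = G (U n)" for n
  have U_Suc: "U 0 = {}" "U (Suc n) = U n \<union> D n" for n
    by (simp_all add: U_def D_def)
  have U_eq: "U n = (\<Union>i<n. D i)" for n
    by (induction n) (auto simp: U_Suc lessThan_Suc)
  have D: "D n \<in> \<P>" "D n \<subseteq> C" "D n \<inter> U n = {}" for n
    using G(1,2)[of "U n"] by (auto simp: D_def)
  then have Dm: "D n \<in> sets M" for n using P by auto
  have disj: "disjoint_family D"
    unfolding disjoint_family_on_def
  proof (intro ballI impI)
    fix m n :: nat assume "m \<noteq> n"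
    then consider "m < n" | "n < m" by linarith
    then show "D m \<inter> D n = {}"
      using D(3)[of m] D(3)[of n] by cases (auto simp: U_eq)
  qed
  have "(\<lambda>n. measure M (D n)) sums measure M (\<Union>n. D n)"
    using Dm disj by (intro finite_measure_UNION) auto
  then have lim: "(\<lambda>n. measure M (D n)) \<longlonglongrightarrow> 0"
    using summable_LIMSEQ_zero sums_summable by blast
  let ?W = "C - (\<Union>n. D n)"
  have W: "?W \<in> sets M" using C Dm by auto
  have "measure M ?W = 0"
  proof (rule ccontr)
    assume "measure M ?W \<noteq> 0"
    then have "0 < measure M ?W" using measure_nonneg[of M ?W] by linarith
    then obtain E where E: "E \<in> \<P>" "E \<subseteq> ?W" "0 < measure M E"
      using step[OF W] by auto
    have "measure M E \<le> 2 * measure M (D n)" for n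
      unfolding D_def using E by (intro G(3)) (auto simp: U_eq)
    moreover have "(\<lambda>n. 2 * measure M (D n)) \<longlonglongrightarrow> 2 * 0"
      by (intro tendsto_intros lim)
    ultimately have "measure M E \<le> 2 * 0"
      by (intro LIMSEQ_le_const[of "\<lambda>n. 2 * measure M (D n)"]) auto
    then show False using E by simp
  qed
  then show thesis using that[OF disj D(1,2)] by blast
qed

context finite_measure
begin

text \<open>Domination by a finite measure turns finite additivity into countable additivity, because the
  tails of the union have small measure.\<close>

lemma dominated_additive_sums:
  fixes \<rho> :: "'a set \<Rightarrow> real"
  assumes add: "\<And>A B. A \<in> sets M \<Longrightarrow> B \<in> sets M \<Longrightarrow> A \<inter> B = {} \<Longrightarrow> \<rho> (A \<union> B) = \<rho> A + \<rho> B"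
    and bound: "\<And>A. A \<in> sets M \<Longrightarrow> \<bar>\<rho> A\<bar> \<le> K * measure M A"
    and D: "\<And>n. D n \<in> sets M" "disjoint_family (D :: nat \<Rightarrow> 'a set)"
  shows "(\<lambda>n. \<rho> (D n)) sums \<rho> (\<Union>n. D n)"
proof -
  let ?T = "\<lambda>n. \<Union>i\<in>{..<n}. D i"
  have dT: "D n \<inter> ?T n = {}" for n
  proof -
    have "D n \<inter> D i = {}" if "i < n" for i
      using D(2) that unfolding disjoint_family_on_def by (metis UNIV_I nat_neq_iff)
    then show ?thesis by auto
  qed
  have rho0: "\<rho> {} = 0" using bound[of "{}"] by simp
  have part: "\<rho> (?T n) = (\<Sum>i<n. \<rho> (D i))" for n
  proof (induction n)
    case (Suc n)
    have "\<rho> (?T n \<union> D n) = \<rho> (?T n) + \<rho> (D n)"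
      using D(1) dT by (intro add) auto
    then show ?case using Suc by (simp add: lessThan_Suc Un_commute add.commute)
  qed (simp add: rho0)
  have mpart: "measure M (?T n) = (\<Sum>i<n. measure M (D i))" for n
    using D by (intro measure_finite_Union) (auto simp: disjoint_family_on_def emeasure_eq_measure)
  have rest: "\<bar>(\<Sum>i<n. \<rho> (D i)) - \<rho> (\<Union>n. D n)\<bar>
      \<le> K * (measure M (\<Union>n. D n) - (\<Sum>i<n. measure M (D i)))" for n
  proof -
    have "?T n \<union> ((\<Union>n. D n) - ?T n) = (\<Union>n. D n)" by auto
    then have "\<rho> (\<Union>n. D n) = \<rho> (?T n) + \<rho> ((\<Union>n. D n) - ?T n)"
      using D(1) add[of "?T n" "(\<Union>n. D n) - ?T n"] by auto
    moreover have "measure M ((\<Union>n. D n) - ?T n) = measure M (\<Union>n. D n) - measure M (?T n)"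
      using D(1) by (intro finite_measure_Diff) auto
    moreover have "\<bar>\<rho> ((\<Union>n. D n) - ?T n)\<bar> \<le> K * measure M ((\<Union>n. D n) - ?T n)"
      using D(1) by (intro bound) auto
    ultimately show ?thesis by (simp add: part mpart)
  qed
  have "(\<lambda>n. measure M (D n)) sums measure M (\<Union>n. D n)"
    using D by (intro finite_measure_UNION) auto
  then have "(\<lambda>n. K * (measure M (\<Union>n. D n) - (\<Sum>i<n. measure M (D i)))) \<longlonglongrightarrow>
      K * (measure M (\<Union>n. D n) - measure M (\<Union>n. D n))"
    unfolding sums_def by (intro tendsto_intros)
  then have "(\<lambda>n. K * (measure M (\<Union>n. D n) - (\<Sum>i<n. measure M (D i)))) \<longlonglongrightarrow> 0" by simp
  moreover have "\<forall>\<^sub>F n in sequentially. norm ((\<Sum>i<n. \<rho> (D i)) - \<rho> (\<Union>n. D n))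
      \<le> K * (measure M (\<Union>n. D n) - (\<Sum>i<n. measure M (D i)))"
    unfolding real_norm_def by (intro always_eventually allI rest)
  ultimately have "(\<lambda>n. (\<Sum>i<n. \<rho> (D i)) - \<rho> (\<Union>n. D n)) \<longlonglongrightarrow> 0"
    by (rule Lim_null_comparison[rotated])
  then show ?thesis unfolding sums_def by (rule LIM_zero_cancel)
qed

text \<open>The part of the Hahn decomposition that is needed for slices: if every subset of \<open>C\<close> of positive
  measure contained a further one on which \<open>\<rho>\<close> is not positive, then exhausting \<open>C\<close> by such sets
  would give \<open>\<rho> C \<le> 0\<close>.\<close>

lemma dominated_additive_positive_set:
  fixes \<rho> :: "'a set \<Rightarrow> real"
  assumes add: "\<And>A B. A \<in> sets M \<Longrightarrow> B \<in> sets M \<Longrightarrow> A \<inter> B = {} \<Longrightarrow> \<rho> (A \<union> B) = \<rho> A + \<rho> B"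
    and bound: "\<And>A. A \<in> sets M \<Longrightarrow> \<bar>\<rho> A\<bar> \<le> K * measure M A"
    and C: "C \<in> sets M" "0 < \<rho> C"
  obtains B where "B \<in> sets M" "B \<subseteq> C" "0 < measure M B"
    "\<And>D. D \<in> sets M \<Longrightarrow> D \<subseteq> B \<Longrightarrow> 0 < measure M D \<Longrightarrow> 0 < \<rho> D"
proof -
  have rho0: "\<rho> {} = 0" using bound[of "{}"] by simp
  have "\<exists>B\<in>sets M. B \<subseteq> C \<and> 0 < measure M B \<and>
      (\<forall>D\<in>sets M. D \<subseteq> B \<longrightarrow> 0 < measure M D \<longrightarrow> 0 < \<rho> D)"
  proof (rule ccontr)
    assume *: "\<not> ?thesis"
    let ?P = "{D \<in> sets M. \<rho> D \<le> 0}"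
    have step: "\<exists>D\<in>?P. D \<subseteq> E \<and> 0 < measure M D"
      if "E \<in> sets M" "E \<subseteq> C" "0 < measure M E" for E
      using that * by (auto simp: not_less)
    obtain D :: "nat \<Rightarrow> 'a set" where D: "disjoint_family D" "\<And>n. D n \<in> ?P"
      "\<And>n. D n \<subseteq> C" "measure M (C - (\<Union>n. D n)) = 0"
      using exhaustion[of C ?P] step C rho0 by auto
    have Dm: "D n \<in> sets M" for n using D(2) by auto
    have "(\<lambda>n. \<rho> (D n)) sums \<rho> (\<Union>n. D n)"
      by (rule dominated_additive_sums[OF add bound Dm D(1)])
    then have "\<rho> (\<Union>n. D n) \<le> 0"
      using D(2) by (rule_tac sums_le[OF _ _ sums_zero]) auto
    moreover have "\<rho> (C - (\<Union>n. D n)) \<le> 0"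
      using bound[of "C - (\<Union>n. D n)"] D(4) C Dm by auto
    moreover have "(\<Union>n. D n) \<union> (C - (\<Union>n. D n)) = C" using D(3) by auto
    then have "\<rho> C = \<rho> (\<Union>n. D n) + \<rho> (C - (\<Union>n. D n))"
      using add[of "\<Union>n. D n" "C - (\<Union>n. D n)"] C Dm by auto
    ultimately show False using C by simp
  qed
  then show thesis using that by blast
qed

text \<open>The averages \<open>\<nu> C / measure M C\<close> over subsets \<open>C\<close> of \<open>E\<close> form a bounded set of functionals, which
  has a slice close to some \<open>L\<close>. One average lies in the slice given by \<open>u\<close> and \<open>c\<close>, that is,
  \<open>\<rho> = \<nu> \<cdot> u - c * measure M\<close> is positive at some \<open>C\<close>; on a subset of \<open>C\<close> where \<open>\<rho>\<close> is positive
  throughout, all averages stay in the slice.\<close>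

lemma exists_small_oscillation_set:
  fixes \<nu> :: "'a set \<Rightarrow> 'x::banach \<Rightarrow>\<^sub>L real"
  assumes asp: "asplund_space TYPE('x)"
    and add: "\<And>A B. A \<in> sets M \<Longrightarrow> B \<in> sets M \<Longrightarrow> A \<inter> B = {} \<Longrightarrow> \<nu> (A \<union> B) = \<nu> A + \<nu> B"
    and bound: "\<And>A. A \<in> sets M \<Longrightarrow> norm (\<nu> A) \<le> measure M A"
    and E: "E \<in> sets M" "0 < measure M E" and e: "0 < e"
  obtains B L where "B \<in> sets M" "B \<subseteq> E" "0 < measure M B"
    "\<And>D. D \<in> sets M \<Longrightarrow> D \<subseteq> B \<Longrightarrow> norm (\<nu> D - measure M D *\<^sub>R L) \<le> e * measure M D"
proof -
  define S where "S = {\<nu> C /\<^sub>R measure M C | C. C \<in> sets M \<and> C \<subseteq> E \<and> 0 < measure M C}"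
  have "norm a \<le> 1" if "a \<in> S" for a
    using that bound by (auto simp: S_def divide_simps)
  then have "bounded S" by (auto simp: bounded_iff)
  moreover have "S \<noteq> {}" using E by (auto simp: S_def)
  ultimately obtain u c L where u: "\<exists>a\<in>S. blinfun_apply a u > c"
    and L: "\<And>a. a \<in> S \<Longrightarrow> blinfun_apply a u > c \<Longrightarrow> norm (a - L) \<le> e"
    using asplund_small_slice[OF asp _ _ e] by metis
  define \<rho> where "\<rho> D = blinfun_apply (\<nu> D) u - c * measure M D" for D
  have quot: "blinfun_apply (\<nu> D /\<^sub>R measure M D) u > c \<longleftrightarrow> 0 < \<rho> D" if "0 < measure M D" for D
    using that by (simp add: \<rho>_def blinfun.scaleR_left field_simps)
  obtain C where C: "C \<in> sets M" "C \<subseteq> E" "0 < measure M C" "0 < \<rho> C"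
    using u quot by (auto simp: S_def)
  obtain B where B: "B \<in> sets M" "B \<subseteq> C" "0 < measure M B"
    "\<And>D. D \<in> sets M \<Longrightarrow> D \<subseteq> B \<Longrightarrow> 0 < measure M D \<Longrightarrow> 0 < \<rho> D"
  proof (rule dominated_additive_positive_set[of \<rho> "norm u + \<bar>c\<bar>" C])
    show "\<rho> (A \<union> B) = \<rho> A + \<rho> B" if "A \<in> sets M" "B \<in> sets M" "A \<inter> B = {}" for A B
      using that by (simp add: \<rho>_def add finite_measure_Union blinfun.add_left algebra_simps)
    show "\<bar>\<rho> A\<bar> \<le> (norm u + \<bar>c\<bar>) * measure M A" if "A \<in> sets M" for A
    proof -
      have "\<bar>blinfun_apply (\<nu> A) u\<bar> \<le> measure M A * norm u"
        using norm_blinfun[of "\<nu> A" u] mult_right_mono[OF bound[OF that] norm_ge_zero[of u]] by simp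
      moreover have "\<bar>c * measure M A\<bar> = \<bar>c\<bar> * measure M A" by (simp add: abs_mult)
      ultimately show ?thesis unfolding \<rho>_def by (simp add: algebra_simps)
    qed
  qed (use C in auto)
  show thesis
  proof (rule that[of B L])
    fix D assume D: "D \<in> sets M" "D \<subseteq> B"
    show "norm (\<nu> D - measure M D *\<^sub>R L) \<le> e * measure M D"
    proof (cases "measure M D = 0")
      case True
      then show ?thesis using bound[OF D(1)] by simp
    next
      case False
      then have pos: "0 < measure M D" using measure_nonneg[of M D] by linarith
      have "norm (\<nu> D /\<^sub>R measure M D - L) \<le> e"
        using D B C pos by (intro L) (auto simp: S_def quot intro!: exI[of _ D])
      moreover have "\<nu> D - measure M D *\<^sub>R L = measure M D *\<^sub>R (\<nu> D /\<^sub>R measure M D - L)"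
        using pos by (simp add: scaleR_diff_right)
      ultimately show ?thesis using pos
        by (simp add: mult.commute mult_right_mono)
    qed
  qed (use B C in auto)
qed

text \<open>The bound on \<open>L n\<close> is automatic on sets of positive measure, since the averages have norm at most
  \<open>1\<close>; it is recorded because the density must turn out bounded.\<close>

lemma small_oscillation_partition:
  fixes \<nu> :: "'a set \<Rightarrow> 'x::banach \<Rightarrow>\<^sub>L real"
  assumes asp: "asplund_space TYPE('x)"
    and add: "\<And>A B. A \<in> sets M \<Longrightarrow> B \<in> sets M \<Longrightarrow> A \<inter> B = {} \<Longrightarrow> \<nu> (A \<union> B) = \<nu> A + \<nu> B"
    and bound: "\<And>A. A \<in> sets M \<Longrightarrow> norm (\<nu> A) \<le> measure M A"
    and e: "0 < e"
  obtains D :: "nat \<Rightarrow> 'a set" and L :: "nat \<Rightarrow> 'x \<Rightarrow>\<^sub>L real" where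
    "disjoint_family D" "\<And>n. D n \<in> sets M" "measure M (space M - (\<Union>n. D n)) = 0"
    "\<And>n. norm (L n) \<le> 1 + e"
    "\<And>n A. A \<in> sets M \<Longrightarrow> A \<subseteq> D n \<Longrightarrow> norm (\<nu> A - measure M A *\<^sub>R L n) \<le> e * measure M A"
proof -
  define \<P> where "\<P> = {B \<in> sets M. \<exists>L. norm L \<le> 1 + e \<and>
    (\<forall>A\<in>sets M. A \<subseteq> B \<longrightarrow> norm (\<nu> A - measure M A *\<^sub>R L) \<le> e * measure M A)}"
  have step: "\<exists>B\<in>\<P>. B \<subseteq> E \<and> 0 < measure M B"
    if E: "E \<in> sets M" "E \<subseteq> space M" "0 < measure M E" for E
  proof -
    obtain B L where B: "B \<in> sets M" "B \<subseteq> E" "0 < measure M B" and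
      L: "\<And>D. D \<in> sets M \<Longrightarrow> D \<subseteq> B \<Longrightarrow> norm (\<nu> D - measure M D *\<^sub>R L) \<le> e * measure M D"
      by (rule exists_small_oscillation_set[OF asp add bound E(1,3) e]) blast+
    have "measure M B * norm L = norm (measure M B *\<^sub>R L)" by simp
    also have "\<dots> \<le> norm (\<nu> B) + norm (\<nu> B - measure M B *\<^sub>R L)"
      by (metis norm_triangle_sub add.commute norm_minus_commute)
    also have "\<dots> \<le> measure M B * (1 + e)"
      using bound[OF B(1)] L[OF B(1)] by (simp add: algebra_simps)
    finally have "norm L \<le> 1 + e" using B(3) by simp
    then have "B \<in> \<P>" using B L unfolding \<P>_def by blast
    then show ?thesis using B by blast
  qed
  have "{} \<in> \<P>" using bound[of "{}"] e by (auto simp: \<P>_def intro!: exI[of _ 0])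
  then obtain D :: "nat \<Rightarrow> 'a set" where D: "disjoint_family D" "\<And>n. D n \<in> \<P>"
    "measure M (space M - (\<Union>n. D n)) = 0"
    using exhaustion[of "space M" \<P>] step by (metis (no_types, lifting) \<P>_def mem_Collect_eq sets.top subsetI)
  then have "\<forall>n. \<exists>L. norm L \<le> 1 + e \<and>
    (\<forall>A\<in>sets M. A \<subseteq> D n \<longrightarrow> norm (\<nu> A - measure M A *\<^sub>R L) \<le> e * measure M A)"
    by (auto simp: \<P>_def)
  then obtain L where L: "\<And>n. norm (L n) \<le> 1 + e"
    "\<And>n A. A \<in> sets M \<Longrightarrow> A \<subseteq> D n \<Longrightarrow> norm (\<nu> A - measure M A *\<^sub>R L n) \<le> e * measure M A"
    by metis
  have "D n \<in> sets M" for n using D(2) by (auto simp: \<P>_def)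
  then show thesis by (rule that[OF D(1) _ D(3) L])
qed

lemma partial_unions_exhaust:
  assumes D: "\<And>n. D n \<in> sets M" "measure M (space M - (\<Union>n::nat. D n)) = 0" and e: "0 < e"
  obtains m where "measure M (space M - (\<Union>n<m. D n)) < e"
proof -
  have "(\<lambda>m. measure M (space M - (\<Union>n<m. D n))) \<longlonglongrightarrow> measure M (\<Inter>m. space M - (\<Union>n<m. D n))"
    using D by (intro finite_Lim_measure_decseq) (force simp: decseq_def)+
  moreover have "(\<Inter>m. space M - (\<Union>n<m. D n)) = space M - (\<Union>n. D n)" by auto
  ultimately have "(\<lambda>m. measure M (space M - (\<Union>n<m. D n))) \<longlonglongrightarrow> 0" using D by simp
  then have "\<forall>\<^sub>F m in sequentially. measure M (space M - (\<Union>n<m. D n)) < e"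
    using e by (rule order_tendstoD)
  then show thesis using that by (auto dest: eventually_happens)
qed

text \<open>The density is the limit of step functions \<open>s j\<close>, which take the value \<open>L j n\<close> on the cell
  \<open>D j n\<close> of a partition with oscillation \<open>e j\<close>. Where cells of two partitions overlap in positive
  measure, the averages over the overlap are close to both values, so the step functions form a
  Cauchy sequence almost everywhere. Convergence is arranged at every point, so that the conclusion
  can be used for any measure with the same \<open>\<sigma>\<close>-algebra.\<close>

theorem asplund_dual_Radon_Nikodym:
  fixes \<nu> :: "'a set \<Rightarrow> 'x::banach \<Rightarrow>\<^sub>L real"
  assumes asp: "asplund_space TYPE('x)"
    and add: "\<And>A B. A \<in> sets M \<Longrightarrow> B \<in> sets M \<Longrightarrow> A \<inter> B = {} \<Longrightarrow> \<nu> (A \<union> B) = \<nu> A + \<nu> B"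
    and bound: "\<And>A. A \<in> sets M \<Longrightarrow> norm (\<nu> A) \<le> measure M A"
  obtains s \<eta> where "\<And>i::nat. simple_function M (s i)"
    "\<And>t. t \<in> space M \<Longrightarrow> (\<lambda>i. s i t) \<longlonglongrightarrow> \<eta> t" "\<And>t. t \<in> space M \<Longrightarrow> norm (\<eta> t) \<le> 2"
    "\<And>A u. A \<in> sets M \<Longrightarrow> blinfun_apply (\<nu> A) u = (\<integral>t. indicator A t * blinfun_apply (\<eta> t) u \<partial>M)"
proof -
  \<comment> \<open>A summable sequence of tolerances: it serves both for the oscillation and, by Borel-Cantelli, for
    the measure of the cells that the finite sums below leave out.\<close>
  define e :: "nat \<Rightarrow> real" where "e j = (1/2) ^ j" for j
  have e: "0 < e j" "e j \<le> 1" for j by (auto simp: e_def power_le_one)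
  have e_lim: "e \<longlonglongrightarrow> 0" unfolding e_def by (intro LIMSEQ_power_zero) auto
  have "\<forall>j. \<exists>D L. disjoint_family (D :: nat \<Rightarrow> 'a set) \<and> (\<forall>n. D n \<in> sets M) \<and> measure M (space M - (\<Union>n. D n)) = 0
    \<and> (\<forall>n. norm (L n) \<le> 1 + e j) \<and>
    (\<forall>n. \<forall>A\<in>sets M. A \<subseteq> D n \<longrightarrow> norm (\<nu> A - measure M A *\<^sub>R L n) \<le> e j * measure M A)"
    by (rule allI, rule small_oscillation_partition[OF asp add bound e(1)], assumption+) blast
  then obtain D L where DL: "\<forall>j. disjoint_family (D j :: nat \<Rightarrow> 'a set) \<and> (\<forall>n. D j n \<in> sets M) \<and> measure M (space M - (\<Union>n. D j n)) = 0
    \<and> (\<forall>n. norm (L j n) \<le> 1 + e j) \<and>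
    (\<forall>n. \<forall>A\<in>sets M. A \<subseteq> D j n \<longrightarrow> norm (\<nu> A - measure M A *\<^sub>R L j n) \<le> e j * measure M A)"
    by metis
  then have D: "\<And>j. disjoint_family (D j)" "\<And>j n. D j n \<in> sets M"
      "\<And>j. measure M (space M - (\<Union>n. D j n)) = 0"
    and L: "\<And>j n. norm (L j n) \<le> 1 + e j"
    and osc: "\<And>j n A. A \<in> sets M \<Longrightarrow> A \<subseteq> D j n \<Longrightarrow> norm (\<nu> A - measure M A *\<^sub>R L j n) \<le> e j * measure M A"
    by blast+
  have "\<forall>j. \<exists>m. measure M (space M - (\<Union>n<m. D j n)) < e j"
    by (rule allI, rule partial_unions_exhaust[OF D(2,3) e(1)]) blast
  then obtain m where m: "\<And>j. measure M (space M - (\<Union>n<m j. D j n)) < e j" by metis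
  define s where "s j t = (\<Sum>n<m j. indicator (D j n) t *\<^sub>R L j n)" for j t
  have s_simple: "simple_function M (s j)" for j
    unfolding s_def
    by (intro simple_function_sum simple_function_compose1[of M "indicator (D j n) :: _ \<Rightarrow> real" "\<lambda>r. r *\<^sub>R L j n" for n]
        simple_function_indicator D)
  have s_eq: "s j t = L j n" if "n < m j" "t \<in> D j n" for j n t
  proof -
    have "indicator (D j i) t *\<^sub>R L j i = (if i = n then L j n else 0)" for i
      using that D(1)[of j] by (auto simp: disjoint_family_on_def indicator_def)
    then show ?thesis using that by (simp add: s_def)
  qed
  have compat: "AE t in M. t \<in> D i n \<inter> D j l \<longrightarrow> norm (L i n - L j l) \<le> e i + e j" for i n j l
  proof (cases "measure M (D i n \<inter> D j l) = 0")
    case True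
    then have "D i n \<inter> D j l \<in> null_sets M"
      using D by (auto simp: null_sets_def emeasure_eq_measure)
    then have "AE t in M. t \<notin> D i n \<inter> D j l" by (rule AE_not_in)
    then show ?thesis by eventually_elim auto
  next
    case False
    let ?A = "D i n \<inter> D j l"
    have pos: "0 < measure M ?A" using False measure_nonneg[of M ?A] by linarith
    have "measure M ?A * norm (L i n - L j l) =
        norm ((\<nu> ?A - measure M ?A *\<^sub>R L j l) - (\<nu> ?A - measure M ?A *\<^sub>R L i n))"
      using pos by (simp add: scaleR_diff_right[symmetric])
    also have "\<dots> \<le> e j * measure M ?A + e i * measure M ?A"
      using D by (intro norm_triangle_le_diff add_mono osc) auto
    also have "\<dots> = measure M ?A * (e i + e j)" by (simp add: algebra_simps)
    finally show ?thesis using pos by simp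
  qed
  have "AE t in M. \<forall>\<^sub>F j in sequentially. t \<in> space M - (space M - (\<Union>n<m j. D j n))"
  proof (rule borel_cantelli_AE1)
    show "summable (\<lambda>j. measure M (space M - (\<Union>n<m j. D j n)))"
    proof (rule summable_comparison_test')
      show "summable e" unfolding e_def by simp
      show "norm (measure M (space M - (\<Union>n<m j. D j n))) \<le> e j" for j
        using m[of j] by simp
    qed
  qed (use D in \<open>auto simp: emeasure_eq_measure\<close>)
  moreover have "AE t in M. \<forall>i n j l. t \<in> D i n \<inter> D j l \<longrightarrow> norm (L i n - L j l) \<le> e i + e j"
    unfolding AE_all_countable by (intro allI compat)
  ultimately have "AE t in M. (\<forall>\<^sub>F j in sequentially. t \<in> (\<Union>n<m j. D j n)) \<and>
      (\<forall>i n j l. t \<in> D i n \<inter> D j l \<longrightarrow> norm (L i n - L j l) \<le> e i + e j)"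
    by eventually_elim (auto elim: eventually_mono)
  then obtain Z where Zp: "\<And>t. t \<in> space M - Z \<Longrightarrow> (\<forall>\<^sub>F j in sequentially. t \<in> (\<Union>n<m j. D j n)) \<and>
      (\<forall>i n j l. t \<in> D i n \<inter> D j l \<longrightarrow> norm (L i n - L j l) \<le> e i + e j)" and Z: "Z \<in> null_sets M"
    by (rule AE_E3) blast
  have ev: "\<forall>\<^sub>F j in sequentially. t \<in> (\<Union>n<m j. D j n)" if "t \<in> space M - Z" for t
    using Zp[OF that] by blast
  have comp: "norm (L i n - L j l) \<le> e i + e j"
    if "t \<in> space M - Z" "t \<in> D i n" "t \<in> D j l" for t i n j l
    using Zp[OF that(1)] that(2,3) by blast
  have ev_near: "\<forall>\<^sub>F i in sequentially. norm (s i t - L j l) \<le> e i + e j"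
    if "t \<in> space M - Z" "t \<in> D j l" for t j l
    using ev[OF that(1)]
  proof eventually_elim
    case (elim i)
    then obtain n where "n < m i" "t \<in> D i n" by auto
    then show ?case using comp[OF that(1) _ that(2)] s_eq by auto
  qed
  have conv: "convergent (\<lambda>j. s j t)" if t: "t \<in> space M - Z" for t
  proof -
    have "Cauchy (\<lambda>j. s j t)"
    proof (rule CauchyI)
      fix r :: real assume "0 < r"
      then have "\<forall>\<^sub>F j in sequentially. e j < r / 4"
        using e_lim by (intro order_tendstoD) auto
      with ev[OF t] have "\<forall>\<^sub>F j in sequentially. t \<in> (\<Union>n<m j. D j n) \<and> e j < r / 4"
        by (rule eventually_conj)
      then obtain N where N: "\<And>j. j \<ge> N \<Longrightarrow> t \<in> (\<Union>n<m j. D j n) \<and> e j < r / 4"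
        by (auto simp: eventually_sequentially)
      have "norm (s i t - s j t) < r" if ij: "i \<ge> N" "j \<ge> N" for i j
      proof -
        obtain n l where "n < m i" "t \<in> D i n" "l < m j" "t \<in> D j l"
          using N[OF ij(1)] N[OF ij(2)] by auto
        then have "norm (s i t - s j t) \<le> e i + e j"
          using comp[OF t] by (simp add: s_eq)
        then show ?thesis using N[OF ij(1)] N[OF ij(2)] \<open>0 < r\<close> by linarith
      qed
      then show "\<exists>N. \<forall>i\<ge>N. \<forall>j\<ge>N. norm (s i t - s j t) < r" by blast
    qed
    then show ?thesis by (rule Cauchy_convergent)
  qed
  \<comment> \<open>Redefining everything as \<open>0\<close> on the null set \<open>Z\<close> turns almost sure into pointwise convergence.\<close>
  define \<eta> where "\<eta> t = (if t \<in> Z then 0 else lim (\<lambda>j. s j t))" for t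
  define s' where "s' j t = (if t \<in> Z then 0 else s j t)" for j t
  have s'_simple: "simple_function M (s' j)" for j
    unfolding s'_def using s_simple Z by (intro simple_function_If_set) auto
  have lim: "(\<lambda>j. s' j t) \<longlonglongrightarrow> \<eta> t" if "t \<in> space M" for t
    using conv[of t] that by (auto simp: \<eta>_def s'_def convergent_LIMSEQ_iff)
  have near: "norm (\<eta> t - L j l) \<le> e j" if "t \<in> space M - Z" "t \<in> D j l" for t j l
  proof (rule tendsto_le[OF _ _ _ ev_near[OF that]])
    show "(\<lambda>i. norm (s i t - L j l)) \<longlonglongrightarrow> norm (\<eta> t - L j l)"
      using lim[of t] that by (intro tendsto_intros) (auto simp: s'_def)
    show "(\<lambda>i. e i + e j) \<longlonglongrightarrow> e j"
      using tendsto_add[OF e_lim tendsto_const, of "e j"] by simp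
  qed simp
  have norm_s: "norm (s' j t) \<le> 2" if ev: "t \<in> (\<Union>n<m j. D j n)" for j t
  proof -
    obtain n where "n < m j" "t \<in> D j n" using ev by auto
    then have "norm (s j t) \<le> 2" using L[of j n] e(2)[of j] by (simp add: s_eq)
    then show ?thesis by (simp add: s'_def)
  qed
  have eta2: "norm (\<eta> t) \<le> 2" if t: "t \<in> space M" for t
  proof (cases "t \<in> Z")
    case False
    show ?thesis
    proof (rule tendsto_upperbound)
      show "(\<lambda>j. norm (s' j t)) \<longlonglongrightarrow> norm (\<eta> t)" by (intro tendsto_norm lim t)
      show "\<forall>\<^sub>F j in sequentially. norm (s' j t) \<le> 2"
        using t False by (intro eventually_mono[OF ev norm_s]) auto
    qed simp
  qed (simp add: \<eta>_def)
  have meas: "(\<lambda>t. blinfun_apply (\<eta> t) u) \<in> borel_measurable M" for u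
  proof (rule borel_measurable_LIMSEQ_metric)
    show "(\<lambda>t. blinfun_apply (s' j t) u) \<in> borel_measurable M" for j
      by (intro borel_measurable_simple_function simple_function_compose1[OF s'_simple])
    show "(\<lambda>j. blinfun_apply (s' j t) u) \<longlonglongrightarrow> blinfun_apply (\<eta> t) u" if "t \<in> space M" for t
      by (intro blinfun.tendsto tendsto_const lim that)
  qed
  have int: "integrable M (\<lambda>t. indicator A t * blinfun_apply (\<eta> t) u)" if "A \<in> sets M" for A u
  proof (rule integrable_const_bound[of _ "2 * norm u"])
    show "AE t in M. norm (indicator A t * blinfun_apply (\<eta> t) u) \<le> 2 * norm u"
    proof (rule AE_I2)
      fix t assume "t \<in> space M"
      then have "norm (blinfun_apply (\<eta> t) u) \<le> 2 * norm u"
        by (intro order_trans[OF norm_blinfun] mult_right_mono eta2) auto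
      then show "norm (indicator A t * blinfun_apply (\<eta> t) u) \<le> 2 * norm u"
        by (auto simp: indicator_def)
    qed
  qed (use meas that in auto)
  have formula: "blinfun_apply (\<nu> A) u = (\<integral>t. indicator A t * blinfun_apply (\<eta> t) u \<partial>M)"
    if A: "A \<in> sets M" for A u
  proof -
    define \<rho> where "\<rho> A = blinfun_apply (\<nu> A) u - (\<integral>t. indicator A t * blinfun_apply (\<eta> t) u \<partial>M)" for A
    have rho_add: "\<rho> (A \<union> B) = \<rho> A + \<rho> B" if "A \<in> sets M" "B \<in> sets M" "A \<inter> B = {}" for A B
    proof -
      have "(\<integral>t. indicator (A \<union> B) t * blinfun_apply (\<eta> t) u \<partial>M)
        = (\<integral>t. indicator A t * blinfun_apply (\<eta> t) u + indicator B t * blinfun_apply (\<eta> t) u \<partial>M)"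
        using that(3) by (intro Bochner_Integration.integral_cong) (auto simp: indicator_def)
      then show ?thesis
        using that int by (simp add: \<rho>_def add blinfun.add_left)
    qed
    have rho_bound: "\<bar>\<rho> B - blinfun_apply (\<nu> B - measure M B *\<^sub>R K) u\<bar> \<le> measure M B * (r * norm u)"
      if B: "B \<in> sets M" and K: "\<And>t. t \<in> B \<Longrightarrow> t \<in> space M - Z \<Longrightarrow> norm (\<eta> t - K) \<le> r" for B K r
    proof -
      have intK: "integrable M (\<lambda>t. indicator B t * blinfun_apply K u)"
        using B by (intro integrable_mult_left integrable_real_indicator) (auto simp: emeasure_eq_measure)
      have "\<rho> B - blinfun_apply (\<nu> B - measure M B *\<^sub>R K) u
        = (\<integral>t. indicator B t * blinfun_apply K u \<partial>M) - (\<integral>t. indicator B t * blinfun_apply (\<eta> t) u \<partial>M)"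
        using B by (simp add: \<rho>_def blinfun.diff_left blinfun.scaleR_left)
      also have "\<dots> = (\<integral>t. indicator B t * blinfun_apply K u - indicator B t * blinfun_apply (\<eta> t) u \<partial>M)"
        by (intro Bochner_Integration.integral_diff[symmetric] intK int B)
      also have "\<bar>\<dots>\<bar> \<le> (\<integral>t. norm (indicator B t * blinfun_apply K u - indicator B t * blinfun_apply (\<eta> t) u) \<partial>M)"
        unfolding real_norm_def[symmetric] by (rule integral_norm_bound)
      also have "\<dots> \<le> (\<integral>t. indicator B t * (r * norm u) \<partial>M)"
      proof (rule integral_mono_AE)
        show "integrable M (\<lambda>t. indicator B t * (r * norm u))"
          using B by (intro integrable_mult_left integrable_real_indicator) (auto simp: emeasure_eq_measure)
      next
        show "integrable M (\<lambda>t. norm (indicator B t * blinfun_apply K u - indicator B t * blinfun_apply (\<eta> t) u))"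
          by (intro integrable_norm Bochner_Integration.integrable_diff intK int B)
      next
        show "AE t in M. norm (indicator B t * blinfun_apply K u - indicator B t * blinfun_apply (\<eta> t) u)
          \<le> indicator B t * (r * norm u)"
          using AE_not_in[OF Z] AE_space
        proof eventually_elim
          case (elim t)
          show ?case
          proof (cases "t \<in> B")
            case True
            have "norm (blinfun_apply (\<eta> t - K) u) \<le> r * norm u"
              using True elim by (intro order_trans[OF norm_blinfun] mult_right_mono K) auto
            then show ?thesis using True by (simp add: blinfun.diff_left abs_minus_commute)
          qed simp
        qed
      qed
      also have "\<dots> = measure M B * (r * norm u)" using B by simp
      finally show ?thesis .
    qed
    have rho_bound1: "\<bar>\<rho> B\<bar> \<le> (3 * norm u) * measure M B" if B: "B \<in> sets M" for B
    proof -
      have "norm (blinfun_apply (\<nu> B) u) \<le> measure M B * norm u"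
        by (intro order_trans[OF norm_blinfun] mult_right_mono bound B) auto
      then show ?thesis
        using rho_bound[OF B, of 0 2] eta2 by (auto simp: algebra_simps abs_le_iff)
    qed
    \<comment> \<open>Inside a single cell, both \<open>\<nu> B\<close> and the integral of \<open>\<eta>\<close> over \<open>B\<close> are close to
      \<open>measure M B *\<^sub>R L j l\<close>; summing over the cells gives the same estimate for every set.\<close>
    have rho_bound2: "\<bar>\<rho> B\<bar> \<le> (2 * e j * norm u) * measure M B"
      if B: "B \<in> sets M" "B \<subseteq> D j l" for B j l
    proof -
      have "norm (blinfun_apply (\<nu> B - measure M B *\<^sub>R L j l) u) \<le> (e j * measure M B) * norm u"
        by (intro order_trans[OF norm_blinfun] mult_right_mono osc B) auto
      moreover have "\<bar>\<rho> B - blinfun_apply (\<nu> B - measure M B *\<^sub>R L j l) u\<bar> \<le> measure M B * (e j * norm u)"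
        using B near by (intro rho_bound) auto
      ultimately show ?thesis by (simp add: algebra_simps abs_le_iff)
    qed
    have "\<bar>\<rho> A\<bar> \<le> (2 * e j * norm u) * measure M A" for j
    proof -
      let ?A = "\<lambda>n. A \<inter> D j n"
      have Am: "?A n \<in> sets M" for n using A D by auto
      have Ad: "disjoint_family ?A" using D(1)[of j] by (auto simp: disjoint_family_on_def)
      have null: "measure M (A - (\<Union>n. ?A n)) = 0"
      proof -
        have "measure M (A - (\<Union>n. ?A n)) \<le> measure M (space M - (\<Union>n. D j n))"
          using A D(2) sets.sets_into_space[OF A] by (intro finite_measure_mono) auto
        then show ?thesis using D(3)[of j] measure_nonneg[of M "A - (\<Union>n. ?A n)"] by linarith
      qed
      have s1: "(\<lambda>n. measure M (?A n)) sums measure M (\<Union>n. ?A n)"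
        using Am Ad by (intro finite_measure_UNION) auto
      then have s2: "(\<lambda>n. (2 * e j * norm u) * measure M (?A n)) sums ((2 * e j * norm u) * measure M (\<Union>n. ?A n))"
        by (rule sums_mult)
      have s3: "(\<lambda>n. \<rho> (?A n)) sums \<rho> (\<Union>n. ?A n)"
        by (rule dominated_additive_sums[OF rho_add rho_bound1 Am Ad])
      have b: "\<bar>\<rho> (?A n)\<bar> \<le> (2 * e j * norm u) * measure M (?A n)" for n
        by (rule rho_bound2[OF Am]) auto
      have "\<bar>\<rho> (\<Union>n. ?A n)\<bar> \<le> (2 * e j * norm u) * measure M (\<Union>n. ?A n)"
        unfolding abs_le_iff
      proof
        show "\<rho> (\<Union>n. ?A n) \<le> (2 * e j * norm u) * measure M (\<Union>n. ?A n)"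
          using b by (intro sums_le[OF _ s3 s2]) (simp add: abs_le_iff)
        show "- \<rho> (\<Union>n. ?A n) \<le> (2 * e j * norm u) * measure M (\<Union>n. ?A n)"
          using b by (intro sums_le[OF _ sums_minus[OF s3] s2]) (simp add: abs_le_iff)
      qed
      moreover have "\<rho> (A - (\<Union>n. ?A n)) = 0"
      proof -
        have "A - (\<Union>n. ?A n) \<in> sets M" using A Am by blast
        from rho_bound1[OF this] null show ?thesis by simp
      qed
      moreover have "\<rho> A = \<rho> (\<Union>n. ?A n) + \<rho> (A - (\<Union>n. ?A n))"
      proof -
        have "(\<Union>n. ?A n) \<in> sets M" "A - (\<Union>n. ?A n) \<in> sets M" using A Am by blast+
        moreover have "(\<Union>n. ?A n) \<union> (A - (\<Union>n. ?A n)) = A" by blast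
        ultimately show ?thesis using rho_add[of "\<Union>n. ?A n" "A - (\<Union>n. ?A n)"] by auto
      qed
      moreover have "(2 * e j * norm u) * measure M (\<Union>n. ?A n) \<le> (2 * e j * norm u) * measure M A"
        using A e(1)[of j] by (intro mult_left_mono finite_measure_mono) auto
      ultimately show ?thesis by linarith
    qed
    moreover have "(\<lambda>j. (2 * e j * norm u) * measure M A) \<longlonglongrightarrow> (2 * 0 * norm u) * measure M A"
      by (intro tendsto_intros e_lim)
    ultimately have "\<bar>\<rho> A\<bar> \<le> (2 * 0 * norm u) * measure M A"
      by (intro LIMSEQ_le_const[of "\<lambda>j. (2 * e j * norm u) * measure M A"]) auto
    then show ?thesis by (simp add: \<rho>_def)
  qed
  show thesis by (rule that[OF s'_simple lim eta2 formula])
qed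

end

section \<open>Strong measurability and Lusin properties\<close>

lemma (in complete_measure) borel_measurable_AE_cong:
  assumes g: "g \<in> borel_measurable M" and ae: "AE t in M. g t = h t"
  shows "h \<in> borel_measurable M"
proof (rule measurableI)
  fix A :: "'b set" assume A: "A \<in> sets borel"
  show "h -` A \<inter> space M \<in> sets M"
  proof (rule in_sets_AE)
    show "AE t in M. t \<in> g -` A \<inter> space M \<longleftrightarrow> t \<in> h -` A \<inter> space M"
      using ae by eventually_elim auto
  qed (use A g in \<open>auto intro: measurable_sets\<close>)
qed simp

lemma strongly_measurable_compose2:
  assumes "strongly_measurable M y" "strongly_measurable M z"
    and "\<And>X Y a b. X \<longlonglongrightarrow> a \<Longrightarrow> Y \<longlonglongrightarrow> b \<Longrightarrow> (\<lambda>i. g (X i) (Y i)) \<longlonglongrightarrow> g a b"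
  shows "strongly_measurable M (\<lambda>t. g (y t) (z t))"
proof -
  obtain r where r: "\<forall>i::nat. simple_function M (r i)" "AE t in M. (\<lambda>i. r i t) \<longlonglongrightarrow> y t"
    using assms(1) unfolding strongly_measurable_def by (elim exE conjE)
  obtain s where s: "\<forall>i::nat. simple_function M (s i)" "AE t in M. (\<lambda>i. s i t) \<longlonglongrightarrow> z t"
    using assms(2) unfolding strongly_measurable_def by (elim exE conjE)
  show ?thesis unfolding strongly_measurable_def
  proof (intro exI conjI allI)
    show "simple_function M (\<lambda>t. g (r i t) (s i t))" for i
      by (rule simple_function_compose2[of M "r i" "s i" g]) (use r(1) s(1) in blast)+
    show "AE t in M. (\<lambda>i. g (r i t) (s i t)) \<longlonglongrightarrow> g (y t) (z t)"
      using r(2) s(2) by eventually_elim (rule assms(3))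
  qed
qed

lemma strongly_measurable_simple:
  "simple_function M y \<Longrightarrow> strongly_measurable M y"
  unfolding strongly_measurable_def by (intro exI[of _ "\<lambda>_. y"]) auto

lemma strongly_measurable_const: "strongly_measurable M (\<lambda>_. c)"
  by (intro strongly_measurable_simple) simp

lemma strongly_measurable_real:
  fixes k :: "'t \<Rightarrow> real"
  assumes "k \<in> borel_measurable M"
  shows "strongly_measurable M k"
proof -
  obtain F where "\<forall>i. simple_function M (F i)" "\<forall>x\<in>space M. (\<lambda>i. F i x) \<longlonglongrightarrow> k x"
    using borel_measurable_implies_sequence_metric[OF assms] by blast
  then show ?thesis unfolding strongly_measurable_def by (intro exI[of _ F]) auto
qed

lemma (in complete_measure) strongly_measurable_imp_borel:
  fixes y :: "'a \<Rightarrow> real"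
  assumes "strongly_measurable M y"
  shows "y \<in> borel_measurable M"
proof -
  obtain s where s: "\<And>i::nat. simple_function M (s i)" "AE t in M. (\<lambda>i. s i t) \<longlonglongrightarrow> y t"
    using assms by (auto simp: strongly_measurable_def)
  have "(\<lambda>t. lim (\<lambda>i. s i t)) \<in> borel_measurable M"
    by (intro borel_measurable_lim_metric borel_measurable_simple_function s)
  moreover have "AE t in M. lim (\<lambda>i. s i t) = y t"
    using s(2) by eventually_elim (rule limI)
  ultimately show ?thesis by (rule borel_measurable_AE_cong)
qed

lemma (in complete_measure) strongly_measurable_norm:
  assumes "strongly_measurable M y"
  shows "(\<lambda>t. norm (y t)) \<in> borel_measurable M"
  by (rule strongly_measurable_imp_borel, rule strongly_measurable_compose2[OF assms assms, of "\<lambda>a b. norm a"])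
    (rule tendsto_norm)

lemma (in complete_measure) strongly_measurable_norm_diff:
  assumes "strongly_measurable M y" "strongly_measurable M z"
  shows "(\<lambda>t. norm (y t - z t)) \<in> borel_measurable M"
  using assms by (intro strongly_measurable_norm strongly_measurable_compose2[of M y z "(-)"] tendsto_diff)

text \<open>The common shape of Lusin's theorem, of inner regularity and of the definition of a Lusin
  integrand, with the property of the compact set as a parameter, so that such properties can be
  combined.\<close>

definition lusin_property :: "'t::metric_space measure \<Rightarrow> ('t set \<Rightarrow> bool) \<Rightarrow> bool" where
  "lusin_property M P \<longleftrightarrow>
     (\<forall>\<epsilon>>0. \<forall>A\<in>sets M. emeasure M A < \<infinity> \<longrightarrow>
        (\<exists>B. compact B \<and> B \<subseteq> A \<and> emeasure M (A - B) < ennreal \<epsilon> \<and> P B))"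

lemma lusin_property_weaken:
  assumes "lusin_property M P" "\<And>B. compact B \<Longrightarrow> P B \<Longrightarrow> Q B"
  shows "lusin_property M Q"
  using assms unfolding lusin_property_def by meson

text \<open>Intersect compact sets that lose at most \<open>\<epsilon> / 2 ^ (n + 2)\<close>, so that the total loss is \<open>\<epsilon> / 2\<close>.\<close>

lemma lusin_property_countable_conj:
  fixes M :: "'t::metric_space measure"
  assumes bor: "sets borel \<subseteq> sets M"
    and P: "\<And>n::nat. lusin_property M (P n)"
    and mono: "\<And>n B C. P n B \<Longrightarrow> C \<subseteq> B \<Longrightarrow> P n C"
  shows "lusin_property M (\<lambda>B. \<forall>n. P n B)"
  unfolding lusin_property_def
proof (intro allI impI ballI)
  fix \<epsilon> :: real and A assume \<epsilon>: "0 < \<epsilon>" and A: "A \<in> sets M" "emeasure M A < \<infinity>"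
  have pos: "0 < \<epsilon> * (1/2)^(n+2)" for n :: nat using \<epsilon> by simp
  have "\<forall>n. \<exists>B. compact B \<and> B \<subseteq> A \<and> emeasure M (A - B) < ennreal (\<epsilon> * (1/2)^(n+2)) \<and> P n B"
    using P pos A unfolding lusin_property_def by blast
  then obtain B where B: "\<And>n. compact (B n)" "\<And>n. B n \<subseteq> A"
    "\<And>n. emeasure M (A - B n) < ennreal (\<epsilon> * (1/2)^(n+2))" "\<And>n. P n (B n)" by metis
  let ?B = "\<Inter>n. B n"
  have Bm: "B n \<in> sets M" for n using bor compact_imp_closed[OF B(1)] by (auto dest: borel_closed)
  have "emeasure M (A - ?B) = emeasure M (\<Union>n. A - B n)" by (rule arg_cong[where f="emeasure M"]) auto
  also have "\<dots> \<le> (\<Sum>n. emeasure M (A - B n))"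
    using A Bm by (intro emeasure_subadditive_countably) auto
  also have "\<dots> \<le> (\<Sum>n. ennreal (\<epsilon> * (1/2)^(n+2)))"
    using B(3) by (intro suminf_le) (auto intro: less_imp_le)
  also have "\<dots> = ennreal (\<Sum>n. \<epsilon> / 4 * (1/2)^n)"
    using \<epsilon> by (subst suminf_ennreal2) (auto simp: power_add intro!: summable_mult)
  also have "(\<Sum>n. \<epsilon> / 4 * (1/2)^n) = \<epsilon> / 2"
    using suminf_geometric[of "1/2::real"] by (subst suminf_mult) auto
  also have "ennreal (\<epsilon> / 2) < ennreal \<epsilon>" using \<epsilon> by (intro ennreal_lessI) auto
  finally have "emeasure M (A - ?B) < ennreal \<epsilon>" .
  moreover have "compact ?B"
  proof -
    have "closed ?B" using B(1) by (intro closed_INT) (auto intro: compact_imp_closed)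
    then have "compact (B 0 \<inter> ?B)" by (intro compact_Int_closed B)
    moreover have "B 0 \<inter> ?B = ?B" by auto
    ultimately show ?thesis by simp
  qed
  ultimately show "\<exists>B. compact B \<and> B \<subseteq> A \<and> emeasure M (A - B) < ennreal \<epsilon> \<and> (\<forall>n. P n B)"
    using B(2) by (intro exI[of _ ?B] conjI allI mono[OF B(4)]) auto
qed

lemma lusin_property_conj:
  fixes M :: "'t::metric_space measure"
  assumes bor: "sets borel \<subseteq> sets M"
    and P: "lusin_property M P" "lusin_property M Q"
    and mono: "\<And>B C. P B \<Longrightarrow> C \<subseteq> B \<Longrightarrow> P C" "\<And>B C. Q B \<Longrightarrow> C \<subseteq> B \<Longrightarrow> Q C"
  shows "lusin_property M (\<lambda>B. P B \<and> Q B)"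
proof -
  have "lusin_property M (\<lambda>B. \<forall>n::nat. (if n = 0 then P else Q) B)"
    using P mono by (intro lusin_property_countable_conj bor) (auto split: if_splits)
  moreover have "(\<forall>n::nat. (if n = 0 then P else Q) B) \<longleftrightarrow> P B \<and> Q B" for B
    by (metis one_neq_zero)
  ultimately show ?thesis by simp
qed

lemma lusin_property_cover:
  fixes M :: "'t::metric_space measure"
  assumes sf: "sigma_finite_measure M" and bor: "sets borel \<subseteq> sets M"
    and P: "lusin_property M P"
  obtains B :: "nat \<Rightarrow> 't set" where "\<And>n. compact (B n)" "\<And>n. B n \<in> sets M"
    "\<And>n. emeasure M (B n) < \<infinity>" "\<And>n. P (B n)" "AE t in M. \<exists>n. t \<in> B n"
proof -
  obtain A :: "nat \<Rightarrow> 't set" where A: "range A \<subseteq> sets M" "(\<Union>i. A i) = space M" "\<And>i. emeasure M (A i) \<noteq> \<infinity>"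
    using sigma_finite_measure.sigma_finite[OF sf] by metis
  have Am: "A i \<in> sets M" for i using A by auto
  have Af: "emeasure M (A i) < \<infinity>" for i using A(3) by (simp add: top.not_eq_extremum)
  have "\<forall>i n. \<exists>B. compact B \<and> B \<subseteq> A i \<and> emeasure M (A i - B) < ennreal (1 / Suc n) \<and> P B"
    using P Am Af unfolding lusin_property_def by (simp add: zero_less_divide_iff)
  then obtain B where B: "\<And>i n. compact (B i n)" "\<And>i n. B i n \<subseteq> A i"
    "\<And>i n. emeasure M (A i - B i n) < ennreal (1 / Suc n)" "\<And>i n. P (B i n)"
    by metis
  have Bm: "B i n \<in> sets M" for i n using bor compact_imp_closed[OF B(1)] by (auto dest: borel_closed)
  have null: "A i - (\<Union>n. B i n) \<in> null_sets M" for i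
  proof -
    have "emeasure M (A i - (\<Union>n. B i n)) \<le> ennreal (1 / Suc n)" for n
      using B(3)[of i n] Am Bm
      by (intro order_trans[OF emeasure_mono[of _ "A i - B i n"] less_imp_le]) auto
    moreover have "(\<lambda>n. ennreal (1 / Suc n)) \<longlonglongrightarrow> ennreal 0"
      by (intro tendsto_ennrealI LIMSEQ_Suc[OF lim_1_over_n[where 'a=real]])
    ultimately have "emeasure M (A i - (\<Union>n. B i n)) \<le> ennreal 0"
      by (intro LIMSEQ_le_const) auto
    then show ?thesis using Am Bm by (auto simp: null_sets_def)
  qed
  have ae: "AE t in M. \<exists>n. t \<in> case_prod B (prod_decode n)"
  proof -
    have "AE t in M. \<forall>i. t \<notin> A i - (\<Union>n. B i n)"
      unfolding AE_all_countable by (intro allI AE_not_in null)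
    then show ?thesis using AE_space
    proof eventually_elim
      case (elim t)
      then obtain i where "t \<in> A i" using A(2) by auto
      then obtain n where "t \<in> B i n" using elim by auto
      then show ?case by (intro exI[of _ "prod_encode (i, n)"]) simp
    qed
  qed
  have fin: "emeasure M (B i n) < \<infinity>" for i n
    using emeasure_mono[OF B(2) Am, of i n] Af[of i] by (rule le_less_trans)
  show thesis
    by (rule that[of "\<lambda>n. case_prod B (prod_decode n)"]) (use B Bm fin ae in \<open>auto split: prod.splits\<close>)
qed

text \<open>Almost everywhere statements may be verified on each of the large compact sets separately, because
  countably many of them cover the space up to a null set.\<close>

lemma lusin_property_AE:
  fixes M :: "'t::metric_space measure"
  assumes sf: "sigma_finite_measure M" and bor: "sets borel \<subseteq> sets M"
    and P: "lusin_property M P"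
    and R: "\<And>B. compact B \<Longrightarrow> B \<in> sets M \<Longrightarrow> emeasure M B < \<infinity> \<Longrightarrow> P B \<Longrightarrow> AE t in M. t \<in> B \<longrightarrow> R t"
  shows "AE t in M. R t"
proof -
  obtain B :: "nat \<Rightarrow> 't set" where B: "\<And>n. compact (B n)" "\<And>n. B n \<in> sets M"
    "\<And>n. emeasure M (B n) < \<infinity>" "\<And>n. P (B n)" "AE t in M. \<exists>n. t \<in> B n"
    using lusin_property_cover[OF sf bor P] by metis
  have "AE t in M. \<forall>n. t \<in> B n \<longrightarrow> R t"
    unfolding AE_all_countable by (intro allI R B)
  with B(5) show ?thesis by eventually_elim auto
qed

lemma lusin_property_measurable:
  fixes M :: "'t::metric_space measure" and g :: "'t \<Rightarrow> real"
  assumes sf: "sigma_finite_measure M" and bor: "sets borel \<subseteq> sets M"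
    and cm: "complete_measure M"
    and P: "lusin_property M P"
    and R: "\<And>B r. compact B \<Longrightarrow> P B \<Longrightarrow> {t\<in>B. g t < r} \<in> sets M"
  shows "g \<in> borel_measurable M"
proof -
  obtain B :: "nat \<Rightarrow> 't set" where B: "\<And>n. compact (B n)" "\<And>n. B n \<in> sets M"
    "\<And>n. P (B n)" "AE t in M. \<exists>n. t \<in> B n"
    using lusin_property_cover[OF sf bor P] by metis
  show ?thesis unfolding borel_measurable_iff_less
  proof
    fix r
    show "{t \<in> space M. g t < r} \<in> sets M"
    proof (rule complete_measure.in_sets_AE[OF cm])
      show "(\<Union>n. {t\<in>B n. g t < r}) \<in> sets M" by (intro sets.countable_UN image_subsetI R B)
      show "AE t in M. t \<in> (\<Union>n. {t\<in>B n. g t < r}) \<longleftrightarrow> t \<in> {t \<in> space M. g t < r}"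
        using B(4) AE_space by eventually_elim auto
    qed auto
  qed
qed

text \<open>One step of Lusin's theorem: the countably many values of the simple functions that approximate \<open>y\<close>
  give a countable partition into sets on which \<open>y\<close> varies by less than \<open>r\<close>. Finitely many compact
  pieces inside these sets fill most of \<open>A\<close>, and disjoint compact sets are separated, so each point
  has a neighbourhood that meets only its own piece.\<close>

lemma strongly_measurable_locally_close:
  fixes M :: "'t::metric_space measure"
  assumes cm: "complete_measure M" and bor: "sets borel \<subseteq> sets M"
    and ir: "inner_regular M" and y: "strongly_measurable M y" and r: "0 < r"
  shows "lusin_property M (\<lambda>B. \<forall>t\<in>B. \<exists>d>0. \<forall>s\<in>B. dist s t < d \<longrightarrow> dist (y s) (y t) < r)"
  unfolding lusin_property_def
proof (intro allI impI ballI)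
  fix \<epsilon> :: real and A assume \<epsilon>: "0 < \<epsilon>" and A: "A \<in> sets M" "emeasure M A < \<infinity>"
  obtain s where s: "\<And>i::nat. simple_function M (s i)" "AE t in M. (\<lambda>i. s i t) \<longlonglongrightarrow> y t"
    using y by (auto simp: strongly_measurable_def)
  define C where "C = insert 0 (\<Union>i. s i ` space M)"
  have "countable C" unfolding C_def
    by (intro countable_insert countable_UN countableI_type countable_finite simple_functionD(1)[OF s(1)])
  define c where "c = from_nat_into C"
  define E where "E n = {t\<in>A. norm (y t - c n) < r / 2}" for n
  have Em: "E n \<in> sets M" for n
  proof -
    have "{t\<in>space M. norm (y t - c n) < r / 2} \<in> sets M"
      using complete_measure.strongly_measurable_norm_diff[OF cm y strongly_measurable_const]
      by (auto intro: borel_measurable_less)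
    moreover have "E n = {t\<in>space M. norm (y t - c n) < r / 2} \<inter> A"
      using sets.sets_into_space[OF A(1)] by (auto simp: E_def)
    ultimately show ?thesis using A by auto
  qed
  define D where "D = disjointed E"
  have Dm: "D n \<in> sets M" for n
    unfolding D_def using Em sets.range_disjointed_sets[of E M] by auto
  have DE: "D n \<subseteq> E n" for n unfolding D_def by (rule disjointed_subset)
  have DA: "D n \<subseteq> A" for n using DE by (auto simp: E_def)
  have Ddisj: "D i \<inter> D j = {}" if "i \<noteq> j" for i j
    using disjoint_family_disjointed[of E] that by (auto simp: D_def disjoint_family_on_def)
  have cover: "AE t in M. t \<notin> A - (\<Union>n. D n)"
    using s(2) AE_space
  proof eventually_elim
    case (elim t)
    show ?case
    proof
      assume t: "t \<in> A - (\<Union>n. D n)"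
      have "\<forall>\<^sub>F i in sequentially. dist (s i t) (y t) < r / 2"
        using elim(1) r by (intro tendstoD) auto
      then obtain i where i: "dist (s i t) (y t) < r / 2" by (auto dest: eventually_happens)
      have "s i t \<in> C" using elim by (auto simp: C_def)
      then obtain n where "c n = s i t"
        using from_nat_into_surj[OF \<open>countable C\<close>] unfolding c_def by blast
      then have "t \<in> E n" using t i by (auto simp: E_def dist_norm norm_minus_commute)
      then show False using t UN_disjointed_eq[of E] unfolding D_def by blast
    qed
  qed
  have fin: "emeasure M (A - X) < \<infinity>" if "X \<in> sets M" for X
    using A(2) emeasure_mono[OF Diff_subset A(1), of X] by (rule le_less_trans[rotated])
  have "(\<lambda>m. measure M (A - (\<Union>n<m. D n))) \<longlonglongrightarrow> measure M (\<Inter>m. A - (\<Union>n<m. D n))"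
  proof (rule Lim_measure_decseq)
    show "range (\<lambda>m. A - (\<Union>n<m. D n)) \<subseteq> sets M" using A Dm by auto
    show "decseq (\<lambda>m. A - (\<Union>n<m. D n))" by (force simp: decseq_def)
    show "emeasure M (A - (\<Union>n<m. D n)) \<noteq> \<infinity>" for m
      using fin[of "\<Union>n<m. D n"] Dm by auto
  qed
  moreover have "(\<Inter>m. A - (\<Union>n<m. D n)) = A - (\<Union>n. D n)" by auto
  moreover have "A - (\<Union>n. D n) \<in> null_sets M"
    using complete_measure.null_sets_iff_AE[OF cm] cover sets.sets_into_space[OF A(1)] by auto
  ultimately have "(\<lambda>m. measure M (A - (\<Union>n<m. D n))) \<longlonglongrightarrow> 0"
    by (simp add: null_setsD1 measure_def)
  then have "\<forall>\<^sub>F m in sequentially. measure M (A - (\<Union>n<m. D n)) < \<epsilon> / 2"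
    using \<epsilon> by (intro order_tendstoD) auto
  then obtain m where m: "measure M (A - (\<Union>n<m. D n)) < \<epsilon> / 2"
    by (auto dest: eventually_happens)
  let ?\<delta> = "\<epsilon> / (2 * (real m + 1))"
  have Dfin: "emeasure M (D n) < \<infinity>" for n
    using A(2) emeasure_mono[OF DA A(1), of n] by (rule le_less_trans[rotated])
  have "?\<delta> > 0" using \<epsilon> by simp
  then have "\<forall>n. \<exists>K. compact K \<and> K \<subseteq> D n \<and> emeasure M (D n - K) < ennreal ?\<delta>"
    using ir Dm Dfin unfolding inner_regular_def by blast
  then obtain K where K: "\<And>n. compact (K n)" "\<And>n. K n \<subseteq> D n" "\<And>n. emeasure M (D n - K n) < ennreal ?\<delta>"
    by metis
  have Km: "K n \<in> sets M" for n using bor compact_imp_closed[OF K(1)] by (auto dest: borel_closed)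
  have K3: "measure M (D n - K n) \<le> ?\<delta>" for n
    using K(3)[of n] \<epsilon> by (auto simp: measure_def intro!: enn2real_leI)
  let ?B = "\<Union>n<m. K n"
  have sub: "?B \<subseteq> A" using K(2) DA by blast
  have "measure M (A - ?B) \<le> measure M ((A - (\<Union>n<m. D n)) \<union> (\<Union>n<m. D n - K n))"
  proof (rule measure_mono_fmeasurable)
    show "(A - (\<Union>n<m. D n)) \<union> (\<Union>n<m. D n - K n) \<in> fmeasurable M"
    proof (rule fmeasurableI2[of A])
      show "A \<in> fmeasurable M" using A by (auto simp: fmeasurable_def)
    qed (use A Dm Km DA in \<open>auto intro!: sets.Un sets.finite_UN sets.Diff\<close>)
  qed (use A Km in auto)
  also have "\<dots> \<le> measure M (A - (\<Union>n<m. D n)) + measure M (\<Union>n<m. D n - K n)"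
    using A Dm Km by (intro measure_Un_le) auto
  also have "measure M (\<Union>n<m. D n - K n) \<le> (\<Sum>n<m. measure M (D n - K n))"
    using Dm Km by (intro measure_UNION_le) auto
  also have "\<dots> \<le> (\<Sum>n<m. ?\<delta>)" by (intro sum_mono K3)
  also have "\<dots> \<le> \<epsilon> / 2" using \<epsilon> by (simp add: field_simps)
  finally have "measure M (A - ?B) < \<epsilon>" using m by simp
  then have "emeasure M (A - ?B) < ennreal \<epsilon>"
    using fin[of ?B] Km \<epsilon> by (auto simp: emeasure_eq_ennreal_measure ennreal_lessI)
  moreover have "compact ?B" using K(1) by (intro compact_UN) auto
  moreover have "\<forall>t\<in>?B. \<exists>d>0. \<forall>s\<in>?B. dist s t < d \<longrightarrow> dist (y s) (y t) < r"
  proof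
    fix t assume "t \<in> ?B"
    then obtain n where n: "n < m" "t \<in> K n" by auto
    let ?F = "\<Union>l\<in>{..<m} - {n}. K l"
    have "closed ?F" using K(1) by (intro closed_UN) (auto intro: compact_imp_closed)
    then have "open (- ?F)" by (rule open_Compl)
    moreover have "t \<in> - ?F" using n K(2) Ddisj by blast
    ultimately obtain d where d: "d > 0" "ball t d \<subseteq> - ?F"
      by (metis open_contains_ball)
    have "dist (y s) (y t) < r" if s: "s \<in> ?B" "dist s t < d" for s
    proof -
      have "s \<in> ball t d" using s(2) by (simp add: dist_commute)
      then have "s \<in> - ?F" using d(2) by blast
      then have "s \<in> K n" using s by auto
      then have "norm (y s - c n) < r / 2" "norm (y t - c n) < r / 2"
        using n K(2)[of n] DE[of n] by (auto simp: E_def)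
      then show ?thesis
        using dist_triangle_half_l[of "y s" "c n" r "y t"] by (simp add: dist_norm)
    qed
    then show "\<exists>d>0. \<forall>s\<in>?B. dist s t < d \<longrightarrow> dist (y s) (y t) < r" using d by blast
  qed
  ultimately show "\<exists>B. compact B \<and> B \<subseteq> A \<and> emeasure M (A - B) < ennreal \<epsilon> \<and>
      (\<forall>t\<in>B. \<exists>d>0. \<forall>s\<in>B. dist s t < d \<longrightarrow> dist (y s) (y t) < r)"
    using sub by (intro exI[of _ ?B] conjI)
qed

lemma strongly_measurable_lusin:
  fixes M :: "'t::metric_space measure"
  assumes cm: "complete_measure M" and bor: "sets borel \<subseteq> sets M"
    and ir: "inner_regular M" and y: "strongly_measurable M y"
  shows "lusin_property M (\<lambda>B. continuous_on B y)"
proof -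
  let ?P = "\<lambda>n B. \<forall>t\<in>B. \<exists>d>0. \<forall>s\<in>B. dist s t < d \<longrightarrow> dist (y s) (y t) < 1 / real (Suc n)"
  have "lusin_property M (\<lambda>B. \<forall>n. ?P n B)"
    by (intro lusin_property_countable_conj bor strongly_measurable_locally_close cm ir y) (simp, blast)
  moreover have "continuous_on B y" if loc: "\<forall>n. ?P n B" for B
    unfolding continuous_on_iff
  proof (intro ballI allI impI)
    fix t and e :: real assume t: "t \<in> B" "0 < e"
    obtain n where n: "1 / real (Suc n) < e" using nat_approx_posE[OF t(2)] by auto
    obtain d where d: "d > 0" "\<forall>s\<in>B. dist s t < d \<longrightarrow> dist (y s) (y t) < 1 / real (Suc n)"
      using bspec[OF spec[OF loc, of n] t(1)] by (elim exE conjE)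
    have "dist (y s) (y t) < e" if "s \<in> B" "dist s t < d" for s
      using d(2) that n by fastforce
    then show "\<exists>d>0. \<forall>s\<in>B. dist s t < d \<longrightarrow> dist (y s) (y t) < e"
      using d(1) by (intro exI[of _ d]) simp
  qed
  ultimately show ?thesis by (rule lusin_property_weaken)
qed

section \<open>Lusin integrands: superposition and exceptional sets\<close>

lemma lsc_multifunction_on_subset:
  assumes "lsc_multifunction_on B F" "C \<subseteq> B"
  shows "lsc_multifunction_on C F"
  unfolding lsc_multifunction_on_def
proof (intro ballI allI impI)
  fix t V assume t: "t \<in> C" and V: "open V \<and> F t \<inter> V \<noteq> {}"
  obtain U where U: "openin (top_of_set B) U" "t \<in> U" "\<forall>s\<in>U. F s \<inter> V \<noteq> {}"
    using assms t V unfolding lsc_multifunction_on_def by (meson subsetD)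
  obtain G where "open G" "U = B \<inter> G" using U(1) by (auto simp: openin_open)
  then have "openin (top_of_set C) (C \<inter> U)"
    using assms(2) by (auto simp: openin_open intro!: exI[of _ G])
  then show "\<exists>U. openin (top_of_set C) U \<and> t \<in> U \<and> (\<forall>s\<in>U. F s \<inter> V \<noteq> {})"
    using U t by (intro exI[of _ "C \<inter> U"]) auto
qed

text \<open>Lower semicontinuity of the epigraphs produces, for \<open>s\<close> near \<open>t\<close>, some \<open>u\<close> near \<open>y t\<close> with
  \<open>g s u\<close> not much larger than \<open>g t (y t)\<close>; the uniform Lipschitz bound then allows to pass from \<open>u\<close>
  to \<open>y s\<close>.\<close>

lemma lsc_epigraph_imp_usc:
  fixes g :: "'t::metric_space \<Rightarrow> 'x::real_normed_vector \<Rightarrow> real"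
  assumes lsc: "lsc_multifunction_on B (\<lambda>t. epi (\<lambda>u. ereal (g t u)))"
    and cont: "continuous_on B x" "continuous_on B y"
    and lip: "\<And>t u v. t \<in> B \<Longrightarrow> u \<in> cball (x t) \<epsilon> \<Longrightarrow> v \<in> cball (x t) \<epsilon> \<Longrightarrow> \<bar>g t u - g t v\<bar> \<le> K * norm (u - v)"
    and K: "0 \<le> K"
    and t: "t \<in> B" "norm (y t - x t) < \<epsilon>" "g t (y t) < r"
  shows "\<exists>d>0. \<forall>s\<in>B. dist s t < d \<longrightarrow> g s (y s) < r"
proof -
  obtain r' where r': "g t (y t) < r'" "r' < r" using t(3) dense by blast
  \<comment> \<open>The first bound keeps \<open>u\<close> and \<open>y s\<close> in the ball around \<open>x s\<close> where the Lipschitz estimate holds;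
    the second makes the resulting error \<open>K * (2 * \<delta>)\<close> smaller than \<open>r - r'\<close>.\<close>
  define \<delta> where "\<delta> = min ((\<epsilon> - norm (y t - x t)) / 2) ((r - r') / (2 * K + 1))"
  have \<delta>: "0 < \<delta>" "2 * \<delta> + norm (y t - x t) \<le> \<epsilon>"
    using t(2) r' K by (auto simp: \<delta>_def min_def field_simps)
  have "(2 * K + 1) * \<delta> \<le> r - r'"
  proof -
    have "\<delta> \<le> (r - r') / (2 * K + 1)" by (simp add: \<delta>_def)
    then show ?thesis using K by (simp add: pos_le_divide_eq mult.commute)
  qed
  then have \<delta>K: "r' + K * (2 * \<delta>) < r" using \<delta>(1) by (simp add: algebra_simps)
  let ?V = "ball (y t) \<delta> \<times> {..<r'}"
  have "open ?V" by (intro open_Times) auto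
  moreover have "(y t, g t (y t)) \<in> epi (\<lambda>u. ereal (g t u)) \<inter> ?V"
    using r' \<delta> by (auto simp: epi_def)
  ultimately obtain U where U: "openin (top_of_set B) U" "t \<in> U"
    "\<forall>s\<in>U. epi (\<lambda>u. ereal (g s u)) \<inter> ?V \<noteq> {}"
    using lsc t(1) unfolding lsc_multifunction_on_def by (metis empty_iff)
  obtain d1 where d1: "d1 > 0" "\<And>s. s \<in> B \<Longrightarrow> dist s t < d1 \<Longrightarrow> s \<in> U"
    using U(1,2) by (metis openin_euclidean_subtopology_iff)
  obtain d2 where d2: "d2 > 0" "\<And>s. s \<in> B \<Longrightarrow> dist s t < d2 \<Longrightarrow> dist (x s) (x t) < \<delta>"
    using cont(1) t(1) \<delta>(1) unfolding continuous_on_iff by metis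
  obtain d3 where d3: "d3 > 0" "\<And>s. s \<in> B \<Longrightarrow> dist s t < d3 \<Longrightarrow> dist (y s) (y t) < \<delta>"
    using cont(2) t(1) \<delta>(1) unfolding continuous_on_iff by metis
  have "g s (y s) < r" if s: "s \<in> B" "dist s t < min d1 (min d2 d3)" for s
  proof -
    have "s \<in> U" and xs: "dist (x s) (x t) < \<delta>" and ys: "dist (y s) (y t) < \<delta>"
      using d1 d2 d3 s by auto
    then obtain u a where ua: "dist (y t) u < \<delta>" "g s u \<le> a" "a < r'"
      using U(3) by (fastforce simp: epi_def)
    have yx: "dist (y t) (x t) + 2 * \<delta> \<le> \<epsilon>" using \<delta> by (simp add: dist_norm)
    have "u \<in> cball (x s) \<epsilon>"
      using dist_triangle[of "x s" u "x t"] dist_triangle[of "x t" u "y t"] xs ua(1) yx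
      by (simp add: dist_commute)
    moreover have "y s \<in> cball (x s) \<epsilon>"
      using dist_triangle[of "x s" "y s" "x t"] dist_triangle[of "x t" "y s" "y t"] xs ys yx
      by (simp add: dist_commute)
    ultimately have "\<bar>g s (y s) - g s u\<bar> \<le> K * dist (y s) u"
      unfolding dist_norm by (intro lip s)
    also have "dist (y s) u \<le> 2 * \<delta>"
      using dist_triangle[of "y s" u "y t"] ys ua(1) by simp
    finally show ?thesis using K ua \<delta>K by (simp add: mult_left_mono)
  qed
  then show ?thesis using d1 d2 d3 by (intro exI[of _ "min d1 (min d2 d3)"]) auto
qed

locale lusin_measure_space = complete_measure M + sigma_finite_measure M
  for M :: "'t::metric_space measure" +
  assumes space_UNIV: "space M = UNIV"
    and borel_sets: "sets borel \<subseteq> sets M"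
    and inner: "inner_regular M"
begin

lemma compact_sets: "compact B \<Longrightarrow> B \<in> sets M"
  using borel_sets by (auto dest: compact_imp_closed borel_closed)

lemma lusin_continuous:
  "strongly_measurable M y \<Longrightarrow> lusin_property M (\<lambda>B. continuous_on B y)"
  by (intro strongly_measurable_lusin complete_measure_axioms borel_sets inner)

lemma lusin_integrand_continuous:
  assumes "lusin_integrand M g" "strongly_measurable M x" "strongly_measurable M y" "k \<in> borel_measurable M"
  shows "lusin_property M (\<lambda>B. lsc_multifunction_on B (\<lambda>t. epi (g t)) \<and> continuous_on B x \<and>
    continuous_on B y \<and> (\<exists>K\<ge>0. \<forall>t\<in>B. (k t :: real) \<le> K))"
proof -
  have "lusin_property M (\<lambda>B. lsc_multifunction_on B (\<lambda>t. epi (g t)))"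
    using assms(1) unfolding lusin_integrand_def lusin_property_def .
  then have "lusin_property M (\<lambda>B. lsc_multifunction_on B (\<lambda>t. epi (g t)) \<and> continuous_on B x \<and>
    continuous_on B y \<and> continuous_on B k)"
    using assms
    by (intro lusin_property_conj lusin_continuous borel_sets strongly_measurable_real)
      (auto intro: lsc_multifunction_on_subset continuous_on_subset)
  then show ?thesis
  proof (rule lusin_property_weaken)
    fix B assume B: "compact B" and *: "lsc_multifunction_on B (\<lambda>t. epi (g t)) \<and> continuous_on B x \<and>
      continuous_on B y \<and> continuous_on B k"
    have "bounded (k ` B)" using B * by (intro compact_imp_bounded compact_continuous_image) auto
    then obtain K where "\<And>t. t \<in> B \<Longrightarrow> \<bar>k t\<bar> \<le> K" by (auto simp: bounded_iff)
    then have "\<exists>K\<ge>0. \<forall>t\<in>B. k t \<le> K"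
      by (intro exI[of _ "max 0 K"]) (auto simp: abs_le_iff le_max_iff_disj)
    with * show "lsc_multifunction_on B (\<lambda>t. epi (g t)) \<and> continuous_on B x \<and>
      continuous_on B y \<and> (\<exists>K\<ge>0. \<forall>t\<in>B. k t \<le> K)" by blast
  qed
qed

lemma superposition_measurable_pointwise:
  fixes g :: "'t \<Rightarrow> 'x::real_normed_vector \<Rightarrow> real"
  assumes g: "lusin_integrand M (\<lambda>t u. ereal (g t u))" and k: "k \<in> borel_measurable M"
    and lip: "\<And>t u v. u \<in> cball (x t) \<epsilon> \<Longrightarrow> v \<in> cball (x t) \<epsilon> \<Longrightarrow> \<bar>g t u - g t v\<bar> \<le> k t * norm (u - v)"
    and xy: "strongly_measurable M x" "strongly_measurable M y" "\<And>t. norm (y t - x t) < \<epsilon>"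
  shows "(\<lambda>t. g t (y t)) \<in> borel_measurable M"
proof (rule lusin_property_measurable[OF sigma_finite_measure_axioms borel_sets complete_measure_axioms
      lusin_integrand_continuous[OF g xy(1,2) k]])
  fix B r assume B: "compact B" and P: "lsc_multifunction_on B (\<lambda>t. epi (\<lambda>u. ereal (g t u))) \<and>
    continuous_on B x \<and> continuous_on B y \<and> (\<exists>K\<ge>0. \<forall>t\<in>B. k t \<le> K)"
  then obtain K where K: "0 \<le> K" "\<And>t. t \<in> B \<Longrightarrow> k t \<le> K" by blast
  define G where "G = \<Union>{ball t d | t d. \<forall>s\<in>B. dist s t < d \<longrightarrow> g s (y s) < r}"
  have lipK: "\<bar>g t u - g t v\<bar> \<le> K * norm (u - v)"
    if "t \<in> B" "u \<in> cball (x t) \<epsilon>" "v \<in> cball (x t) \<epsilon>" for t u v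
    by (rule order_trans[OF lip[OF that(2,3)] mult_right_mono[OF K(2)[OF that(1)]]]) simp
  have "t \<in> G" if t: "t \<in> B" "g t (y t) < r" for t
  proof -
    obtain d where "d > 0" "\<forall>s\<in>B. dist s t < d \<longrightarrow> g s (y s) < r"
      using lsc_epigraph_imp_usc[of B g x y \<epsilon> K t r, OF _ _ _ lipK K(1) t(1) xy(3) t(2)] P by blast
    then show ?thesis unfolding G_def by (intro UnionI[of "ball t d"]) auto
  qed
  moreover have "g t (y t) < r" if "t \<in> B" "t \<in> G" for t
    using that by (auto simp: G_def dist_commute)
  ultimately have "{t \<in> B. g t (y t) < r} = B \<inter> G" by blast
  moreover have "open G" unfolding G_def by (intro open_Union) auto
  ultimately show "{t \<in> B. g t (y t) < r} \<in> sets M"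
    using compact_sets[OF B] borel_sets by (metis borel_open sets.Int subsetD)
qed

lemma strongly_measurable_AE_cong:
  assumes "strongly_measurable M y" "AE t in M. y t = z t"
  shows "strongly_measurable M z"
proof -
  obtain s where s: "\<forall>i::nat. simple_function M (s i)" "AE t in M. (\<lambda>i. s i t) \<longlonglongrightarrow> y t"
    using assms(1) unfolding strongly_measurable_def by (elim exE conjE)
  have "AE t in M. (\<lambda>i. s i t) \<longlonglongrightarrow> z t" using s(2) assms(2) by eventually_elim simp
  then show ?thesis using s(1) unfolding strongly_measurable_def by (intro exI[of _ s] conjI)
qed

text \<open>Off the null set where \<open>y\<close> leaves the ball around \<open>x\<close>, \<open>y\<close> may be replaced by \<open>x\<close>, which reduces
  the claim to the pointwise condition; completeness of the measure absorbs the change.\<close>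

lemma superposition_measurable:
  fixes g :: "'t \<Rightarrow> 'x::real_normed_vector \<Rightarrow> real"
  assumes g: "lusin_integrand M (\<lambda>t u. ereal (g t u))" and k: "k \<in> borel_measurable M"
    and lip: "\<And>t u v. u \<in> cball (x t) \<epsilon> \<Longrightarrow> v \<in> cball (x t) \<epsilon> \<Longrightarrow> \<bar>g t u - g t v\<bar> \<le> k t * norm (u - v)"
    and \<epsilon>: "0 < \<epsilon>"
    and xy: "strongly_measurable M x" "strongly_measurable M y" "AE t in M. norm (y t - x t) < \<epsilon>"
  shows "(\<lambda>t. g t (y t)) \<in> borel_measurable M"
proof -
  define z where "z t = (if norm (y t - x t) < \<epsilon> then y t else x t)" for t
  have ae: "AE t in M. y t = z t" using xy(3) by eventually_elim (simp add: z_def)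
  have "(\<lambda>t. g t (z t)) \<in> borel_measurable M"
    using strongly_measurable_AE_cong[OF xy(2) ae] \<epsilon>
    by (intro superposition_measurable_pointwise[OF g k lip xy(1)]) (auto simp: z_def)
  moreover have "AE t in M. g t (z t) = g t (y t)" using ae by eventually_elim simp
  ultimately show ?thesis by (rule borel_measurable_AE_cong)
qed

text \<open>A substitute for the Lindelof property: a compact subset of the union is covered by finitely many
  of the null sets, and by inner regularity such compact subsets exhaust the union.\<close>

lemma null_open_cover:
  assumes B: "B \<in> sets M" "emeasure M B < \<infinity>"
    and \<O>: "\<And>W. W \<in> \<O> \<Longrightarrow> open W" "\<And>W. W \<in> \<O> \<Longrightarrow> B \<inter> W \<in> null_sets M"
  shows "B \<inter> \<Union>\<O> \<in> null_sets M"
proof -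
  have "open (\<Union>\<O>)" using \<O>(1) by blast
  then have m: "B \<inter> \<Union>\<O> \<in> sets M" using B(1) borel_sets by (meson borel_open sets.Int subsetD)
  have fin: "emeasure M (B \<inter> \<Union>\<O>) < \<infinity>"
    using B by (meson emeasure_mono inf_le1 le_less_trans)
  have small: "emeasure M (B \<inter> \<Union>\<O>) \<le> ennreal e" if e: "0 < e" for e
  proof -
    obtain K where K: "compact K" "K \<subseteq> B \<inter> \<Union>\<O>" "emeasure M (B \<inter> \<Union>\<O> - K) < ennreal e"
      using inner e m fin unfolding inner_regular_def by blast
    obtain \<F> where \<F>: "\<F> \<subseteq> \<O>" "finite \<F>" "K \<subseteq> \<Union>\<F>"
      by (rule compactE[OF K(1), of \<O>]) (use K(2) \<O>(1) in blast)+
    have "(\<Union>W\<in>\<F>. B \<inter> W) \<in> null_sets M"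
      using \<F>(1,2) \<O>(2) by (intro null_sets_UN' countable_finite) blast+
    moreover have "K \<subseteq> (\<Union>W\<in>\<F>. B \<inter> W)" using \<F>(3) K(2) by blast
    ultimately have "K \<in> null_sets M" by (rule complete2[rotated])
    then have "emeasure M (B \<inter> \<Union>\<O>) = emeasure M (B \<inter> \<Union>\<O> - K)"
      using m by (simp add: emeasure_Diff_null_set)
    then show ?thesis using K(3) by simp
  qed
  have "emeasure M (B \<inter> \<Union>\<O>) \<le> 0"
    by (rule ennreal_le_epsilon) (simp add: small)
  then show ?thesis using m by (simp add: null_sets_def)
qed

text \<open>The exceptional null sets for the single directions \<open>u\<close> are uncountably many. A violation at \<open>t\<close> in
  direction \<open>u\<close> extends to a relatively open neighbourhood of \<open>t\<close> in a compact set \<open>B\<close>, since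
  \<open>\<xi> \<cdot> u\<close> is continuous and \<open>h \<cdot> u\<close> is upper semicontinuous there; that neighbourhood lies in the
  exceptional set of \<open>u\<close>, so it is null, and the union of all of them is still null.\<close>

lemma AE_all_directions:
  fixes h :: "'t \<Rightarrow> 'x::real_normed_vector \<Rightarrow> real" and \<xi> :: "'t \<Rightarrow> 'x \<Rightarrow>\<^sub>L real"
  assumes h: "lusin_integrand M (\<lambda>t u. ereal (h t u))" and k: "k \<in> borel_measurable M"
    and lip: "\<And>t u v. \<bar>h t u - h t v\<bar> \<le> k t * norm (u - v)"
    and \<xi>: "strongly_measurable M \<xi>"
    and ae: "\<And>u. AE t in M. blinfun_apply (\<xi> t) u \<le> h t u"
  shows "AE t in M. \<forall>u. blinfun_apply (\<xi> t) u \<le> h t u"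
proof (rule lusin_property_AE[OF sigma_finite_measure_axioms borel_sets
      lusin_integrand_continuous[OF h \<xi> \<xi> k]])
  fix B assume B: "compact B" "B \<in> sets M" "emeasure M B < \<infinity>"
    and P: "lsc_multifunction_on B (\<lambda>t. epi (\<lambda>u. ereal (h t u))) \<and>
      continuous_on B \<xi> \<and> continuous_on B \<xi> \<and> (\<exists>K\<ge>0. \<forall>t\<in>B. k t \<le> K)"
  then obtain K where K: "0 \<le> K" "\<And>t. t \<in> B \<Longrightarrow> k t \<le> K" by blast
  define \<O> where "\<O> = {ball t d | t d. \<exists>u. \<forall>s\<in>B. dist s t < d \<longrightarrow> h s u < blinfun_apply (\<xi> s) u}"
  have "B \<inter> \<Union>\<O> \<in> null_sets M"
  proof (rule null_open_cover[OF B(2,3)])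
    fix W assume "W \<in> \<O>"
    then obtain t d u where W: "W = ball t d" "\<And>s. s \<in> B \<Longrightarrow> dist s t < d \<Longrightarrow> h s u < blinfun_apply (\<xi> s) u"
      by (auto simp: \<O>_def)
    have "AE s in M. s \<notin> B \<inter> W"
      using ae[of u]
    proof eventually_elim
      case (elim s)
      then show ?case using W(2)[of s] by (auto simp: W(1) dist_commute)
    qed
    then show "B \<inter> W \<in> null_sets M" by (simp add: null_sets_iff_AE space_UNIV)
  qed (auto simp: \<O>_def)
  then have "AE t in M. t \<notin> B \<inter> \<Union>\<O>" by (rule AE_not_in)
  then show "AE t in M. t \<in> B \<longrightarrow> (\<forall>u. blinfun_apply (\<xi> t) u \<le> h t u)"
  proof eventually_elim
    case (elim t)
    show ?case
    proof (intro impI allI, rule ccontr)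
      fix u assume t: "t \<in> B" and "\<not> blinfun_apply (\<xi> t) u \<le> h t u"
      then obtain c where c: "h t u < c" "c < blinfun_apply (\<xi> t) u" using dense by (meson not_le)
      have "\<exists>d>0. \<forall>s\<in>B. dist s t < d \<longrightarrow> h s u < c"
      proof (rule lsc_epigraph_imp_usc[where x="\<lambda>_. u" and y="\<lambda>_. u" and \<epsilon>=1 and K=K])
        show "\<bar>h t u - h t v\<bar> \<le> K * norm (u - v)" if "t \<in> B" for t u v
          by (rule order_trans[OF lip mult_right_mono[OF K(2)[OF that]]]) simp
      qed (use P K t c in auto)
      then obtain d1 where d1: "d1 > 0" "\<forall>s\<in>B. dist s t < d1 \<longrightarrow> h s u < c" by blast
      have "continuous_on B (\<lambda>s. blinfun_apply (\<xi> s) u)"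
        using P by (intro continuous_intros) auto
      then obtain d2 where d2: "d2 > 0" "\<forall>s\<in>B. dist s t < d2 \<longrightarrow>
          dist (blinfun_apply (\<xi> s) u) (blinfun_apply (\<xi> t) u) < blinfun_apply (\<xi> t) u - c"
        using t c unfolding continuous_on_iff by (metis diff_gt_0_iff_gt)
      have "h s u < blinfun_apply (\<xi> s) u" if s: "s \<in> B" "dist s t < min d1 d2" for s
      proof -
        have "h s u < c" using d1 s by auto
        moreover have "\<bar>blinfun_apply (\<xi> s) u - blinfun_apply (\<xi> t) u\<bar> < blinfun_apply (\<xi> t) u - c"
          using d2 s by (auto simp: dist_real_def)
        ultimately show ?thesis by linarith
      qed
      then have "ball t (min d1 d2) \<in> \<O>" unfolding \<O>_def by blast
      then show False using elim t d1(1) d2(1) by (metis IntI UnionI centre_in_ball min_less_iff_conj)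
    qed
  qed
qed

end

section \<open>The Clarke directional derivative of a Lipschitz function\<close>

lemma clarke_filter_nontrivial: "nhds (z::'x::real_normed_vector) \<times>\<^sub>F at_right (0::real) \<noteq> bot"
  by (simp add: prod_filter_eq_bot)

lemma clarke_filter_eventually_near:
  fixes z v :: "'x::real_normed_vector"
  assumes "0 < \<epsilon>"
  shows "\<forall>\<^sub>F p in nhds z \<times>\<^sub>F at_right (0::real). 0 < snd p \<and> fst p + snd p *\<^sub>R v \<in> cball z \<epsilon>"
proof -
  let ?F = "nhds z \<times>\<^sub>F at_right (0::real)"
  have f: "filterlim fst (nhds z) ?F" by (rule filterlim_fst)
  have s: "filterlim snd (at_right (0::real)) ?F" by (rule filterlim_snd)
  have "(snd \<longlongrightarrow> 0) ?F"
    using s unfolding filterlim_at by blast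
  then have "((\<lambda>p. fst p + snd p *\<^sub>R v) \<longlongrightarrow> z + 0 *\<^sub>R v) ?F"
    using f by (intro tendsto_intros)
  then have "\<forall>\<^sub>F p in ?F. dist (fst p + snd p *\<^sub>R v) z < \<epsilon>"
    using assms by (intro tendstoD) auto
  moreover have "\<forall>\<^sub>F p in ?F. 0 < snd p"
    using eventually_at_right_less[of "0::real"] s by (rule eventually_compose_filterlim)
  ultimately show ?thesis
    by eventually_elim (auto simp: dist_commute intro: less_imp_le)
qed

lemma clarke_dd_zero: "clarke_dd g z 0 = 0"
  using Limsup_const[OF clarke_filter_nontrivial, of z "0::ereal"]
  by (simp add: clarke_dd_def case_prod_beta' zero_ereal_def[symmetric])

context
  fixes g :: "'x::real_normed_vector \<Rightarrow> real" and z :: 'x and k \<epsilon> :: real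
  assumes eps: "0 < \<epsilon>"
    and lip: "\<And>u v. u \<in> cball z \<epsilon> \<Longrightarrow> v \<in> cball z \<epsilon> \<Longrightarrow> \<bar>g u - g v\<bar> \<le> k * norm (u - v)"
begin

lemma clarke_dd_le_add: "clarke_dd g z v \<le> clarke_dd g z w + ereal (k * norm (v - w))"
proof -
  let ?F = "nhds z \<times>\<^sub>F at_right (0::real)"
  let ?q = "\<lambda>v p. ereal ((g (fst p + snd p *\<^sub>R v) - g (fst p)) / snd p)"
  have "\<forall>\<^sub>F p in ?F. ?q v p \<le> ?q w p + ereal (k * norm (v - w))"
    using clarke_filter_eventually_near[OF eps, where z=z and v=v]
      clarke_filter_eventually_near[OF eps, where z=z and v=w]
  proof eventually_elim
    case (elim p)
    have "g (fst p + snd p *\<^sub>R v) - g (fst p + snd p *\<^sub>R w)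
      \<le> k * norm ((fst p + snd p *\<^sub>R v) - (fst p + snd p *\<^sub>R w))"
      using lip elim abs_le_D1 by blast
    also have "(fst p + snd p *\<^sub>R v) - (fst p + snd p *\<^sub>R w) = snd p *\<^sub>R (v - w)"
      by (simp add: scaleR_diff_right)
    finally have "g (fst p + snd p *\<^sub>R v) - g (fst p)
      \<le> (g (fst p + snd p *\<^sub>R w) - g (fst p)) + k * norm (v - w) * snd p"
      using elim by (simp add: mult.commute mult.left_commute)
    then show ?case using elim by (simp add: divide_le_eq distrib_right)
  qed
  then have "Limsup ?F (?q v) \<le> Limsup ?F (\<lambda>p. ?q w p + ereal (k * norm (v - w)))"
    by (rule Limsup_mono)
  also have "\<dots> = Limsup ?F (?q w) + ereal (k * norm (v - w))"
    by (rule Limsup_add_ereal_right[OF clarke_filter_nontrivial]) simp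
  finally show ?thesis by (simp add: clarke_dd_def case_prod_beta')
qed

lemma clarke_dd_eq_real: "clarke_dd g z v = ereal (real_of_ereal (clarke_dd g z v))"
proof -
  have "clarke_dd g z v \<noteq> \<infinity>" "clarke_dd g z v \<noteq> -\<infinity>"
    using clarke_dd_le_add[of v 0] clarke_dd_le_add[of 0 v] by (auto simp: clarke_dd_zero)
  then show ?thesis by (cases "clarke_dd g z v") auto
qed

lemma clarke_dd_lipschitz:
  "\<bar>real_of_ereal (clarke_dd g z v) - real_of_ereal (clarke_dd g z w)\<bar> \<le> k * norm (v - w)"
proof -
  have "real_of_ereal (clarke_dd g z v) \<le> real_of_ereal (clarke_dd g z w) + k * norm (v - w)" for v w
    using clarke_dd_le_add[of v w]
    by (metis clarke_dd_eq_real ereal_less_eq(3) plus_ereal.simps(1))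
  from this[of v w] this[of w v] show ?thesis by (simp add: norm_minus_commute abs_le_iff)
qed

text \<open>The upper limit over all pairs dominates the one along any sequence, and this is the form in which
  it enters the dominated convergence argument.\<close>

lemma clarke_dd_sequence:
  assumes y: "Y \<longlonglongrightarrow> z" and s: "s \<longlonglongrightarrow> 0" "\<And>n. 0 < s n"
    and r: "real_of_ereal (clarke_dd g z v) < r"
  shows "\<forall>\<^sub>F n in sequentially. (g (Y n + s n *\<^sub>R v) - g (Y n)) / s n < r"
proof -
  let ?F = "nhds z \<times>\<^sub>F at_right (0::real)"
  have "clarke_dd g z v < ereal r" using r clarke_dd_eq_real[of v] by (metis ereal_less_eq(3) not_le)
  then have "\<forall>\<^sub>F p in ?F. (\<lambda>(y, s). ereal ((g (y + s *\<^sub>R v) - g y) / s)) p < ereal r"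
    unfolding clarke_dd_def by (rule Limsup_lessD)
  moreover have "filterlim s (at_right 0) sequentially"
    unfolding filterlim_at using s by (auto simp: less_imp_neq[THEN not_sym])
  then have "filterlim (\<lambda>n. (Y n, s n)) ?F sequentially"
    by (intro filterlim_Pair y)
  ultimately have "\<forall>\<^sub>F n in sequentially. (\<lambda>(y, s). ereal ((g (y + s *\<^sub>R v) - g y) / s)) (Y n, s n) < ereal r"
    by (rule eventually_compose_filterlim)
  then show ?thesis by simp
qed

end

section \<open>Essentially bounded functions\<close>

lemma Linf_add: "y \<in> Linf M \<Longrightarrow> z \<in> Linf M \<Longrightarrow> (\<lambda>t. y t + z t) \<in> Linf M"
proof -
  assume y: "y \<in> Linf M" and z: "z \<in> Linf M"
  obtain C D where "AE t in M. norm (y t) \<le> C" "AE t in M. norm (z t) \<le> D"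
    using y z by (auto simp: Linf_def)
  then have "AE t in M. norm (y t + z t) \<le> C + D"
    by eventually_elim (intro norm_triangle_le add_mono)
  moreover have "strongly_measurable M (\<lambda>t. y t + z t)"
    using y z by (intro strongly_measurable_compose2[of M y z "(+)"] tendsto_add) (auto simp: Linf_def)
  ultimately show ?thesis by (auto simp: Linf_def)
qed

lemma Linf_scaleR: "y \<in> Linf M \<Longrightarrow> (\<lambda>t. c *\<^sub>R y t) \<in> Linf M"
proof -
  assume y: "y \<in> Linf M"
  obtain C where "AE t in M. norm (y t) \<le> C" using y by (auto simp: Linf_def)
  then have "AE t in M. norm (c *\<^sub>R y t) \<le> \<bar>c\<bar> * C"
    by eventually_elim (auto intro: mult_left_mono)
  moreover have "strongly_measurable M (\<lambda>t. c *\<^sub>R y t)"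
    using y by (intro strongly_measurable_compose2[of M y y "\<lambda>a b. c *\<^sub>R a"] tendsto_intros) (auto simp: Linf_def)
  ultimately show ?thesis by (auto simp: Linf_def)
qed

lemma Linf_diff:
  assumes "y \<in> Linf M" "z \<in> Linf M"
  shows "(\<lambda>t. y t - z t) \<in> Linf M"
  using Linf_add[OF assms(1) Linf_scaleR[OF assms(2), of "-1"]] by simp

lemma Linf_simple: "simple_function M y \<Longrightarrow> y \<in> Linf M"
proof -
  assume y: "simple_function M y"
  then have "bounded (y ` space M)" by (intro finite_imp_bounded simple_functionD)
  then obtain C where "\<forall>t\<in>space M. norm (y t) \<le> C" by (auto simp: bounded_iff)
  then show ?thesis using strongly_measurable_simple[OF y] by (auto simp: Linf_def)
qed

lemma Linf_indicator: "A \<in> sets M \<Longrightarrow> (\<lambda>t. indicator A t *\<^sub>R u) \<in> Linf M"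
  by (intro Linf_simple simple_function_compose1[of M "indicator A :: _ \<Rightarrow> real" "\<lambda>r. r *\<^sub>R u"]
      simple_function_indicator)

context complete_measure
begin

text \<open>The content is that the essential supremum is finite: \<open>enn2real\<close> would turn an infinite one into
  \<open>0\<close>.\<close>

lemma Linf_norm_AE:
  assumes "y \<in> Linf M"
  shows "AE t in M. norm (y t) \<le> Linf_norm M y"
proof -
  obtain C where C: "AE t in M. norm (y t) \<le> C" and y: "strongly_measurable M y"
    using assms by (auto simp: Linf_def)
  have "(\<lambda>t. ennreal (norm (y t))) \<in> borel_measurable M"
    using strongly_measurable_norm[OF y] by measurable
  moreover have "AE t in M. ennreal (norm (y t)) \<le> ennreal C"
    using C by eventually_elim (rule ennreal_leI)
  ultimately have "esssup M (\<lambda>t. ennreal (norm (y t))) \<le> ennreal C" by (rule esssup_I)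
  then have fin: "esssup M (\<lambda>t. ennreal (norm (y t))) < top"
    by (rule le_less_trans) simp
  have "AE t in M. ennreal (norm (y t)) \<le> esssup M (\<lambda>t. ennreal (norm (y t)))" by (rule esssup_AE)
  then show ?thesis
  proof eventually_elim
    case (elim t)
    then have "ennreal (norm (y t)) \<le> ennreal (Linf_norm M y)"
      using fin by (simp add: Linf_norm_def)
    then show ?case by (simp add: ennreal_le_iff Linf_norm_def)
  qed
qed

lemma weighted_norm_integrable:
  assumes k: "integrable M k" "\<And>t. 0 \<le> k t" and y: "y \<in> Linf M"
  shows "integrable M (\<lambda>t. k t * norm (y t))"
proof -
  obtain C where C: "AE t in M. norm (y t) \<le> C" using y by (auto simp: Linf_def)
  show ?thesis
  proof (rule Bochner_Integration.integrable_bound)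
    show "integrable M (\<lambda>t. k t * C)" using k by simp
    show "(\<lambda>t. k t * norm (y t)) \<in> borel_measurable M"
      using y k by (intro borel_measurable_times strongly_measurable_norm) (auto simp: Linf_def)
    show "AE t in M. norm (k t * norm (y t)) \<le> norm (k t * C)"
      using C by eventually_elim (use k in \<open>auto simp: abs_mult intro!: mult_left_mono\<close>)
  qed
qed

end

lemma Linf_filter_eventually:
  assumes "0 < \<delta>"
  shows "\<forall>\<^sub>F p in Linf_nhds M x \<times>\<^sub>F at_right (0::real). fst p \<in> Linf M \<and>
    Linf_norm M (\<lambda>t. fst p t - x t) < \<delta> \<and> 0 < snd p \<and> snd p < \<delta>"
proof -
  have 1: "\<forall>\<^sub>F y in Linf_nhds M x. y \<in> Linf M \<and> Linf_norm M (\<lambda>t. y t - x t) < \<delta>"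
    unfolding Linf_nhds_def using assms by (intro eventually_INF1[of \<delta>]) (auto simp: eventually_principal)
  have 2: "\<forall>\<^sub>F s in at_right (0::real). 0 < s \<and> s < \<delta>"
    using assms eventually_at_right_real by (auto elim: eventually_mono)
  show ?thesis unfolding eventually_prod_filter
    using 1 2 by (intro exI conjI) (assumption | auto)+
qed

section \<open>The Clarke derivative of an integral functional\<close>

locale clarke_integral_setting = lusin_measure_space M
  for M :: "'t::metric_space measure" +
  fixes f :: "'t \<Rightarrow> 'x::banach \<Rightarrow> real" and x :: "'t \<Rightarrow> 'x" and k :: "'t \<Rightarrow> real" and \<epsilon> :: real
  assumes x: "x \<in> Linf M"
    and f: "lusin_integrand M (\<lambda>t u. ereal (f t u))"
    and k: "integrable M k" "\<And>t. 0 \<le> k t"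
    and eps: "0 < \<epsilon>"
    and lip: "\<And>t u v. u \<in> cball (x t) \<epsilon> \<Longrightarrow> v \<in> cball (x t) \<epsilon> \<Longrightarrow> \<bar>f t u - f t v\<bar> \<le> k t * norm (u - v)"
    and int_fx: "integrable M (\<lambda>t. f t (x t))"
    and dd: "lusin_integrand M (\<lambda>t. clarke_dd (f t) (x t))"
begin

definition pointwise_dd :: "'t \<Rightarrow> 'x \<Rightarrow> real" where
  "pointwise_dd t v = real_of_ereal (clarke_dd (f t) (x t) v)"

lemma dd_eq: "clarke_dd (f t) (x t) v = ereal (pointwise_dd t v)"
  unfolding pointwise_dd_def by (rule clarke_dd_eq_real[OF eps lip])

lemma pointwise_dd_lusin: "lusin_integrand M (\<lambda>t u. ereal (pointwise_dd t u))"
  using dd by (simp add: dd_eq[symmetric])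

lemma pointwise_dd_lipschitz: "\<bar>pointwise_dd t u - pointwise_dd t v\<bar> \<le> k t * norm (u - v)"
  unfolding pointwise_dd_def by (rule clarke_dd_lipschitz[OF eps lip])

lemma pointwise_dd_zero: "pointwise_dd t 0 = 0"
  unfolding pointwise_dd_def by (simp add: clarke_dd_zero)

lemma pointwise_dd_bound: "\<bar>pointwise_dd t u\<bar> \<le> k t * norm u"
  using pointwise_dd_lipschitz[of t u 0] by (simp add: pointwise_dd_zero)

lemma pointwise_dd_measurable: "v \<in> Linf M \<Longrightarrow> (\<lambda>t. pointwise_dd t (v t)) \<in> borel_measurable M"
  using k(1) by (intro superposition_measurable[OF pointwise_dd_lusin, of k v 1 v] pointwise_dd_lipschitz) (auto simp: Linf_def)

lemma pointwise_dd_integrable: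
  assumes "v \<in> Linf M"
  shows "integrable M (\<lambda>t. pointwise_dd t (v t))"
  by (rule Bochner_Integration.integrable_bound[OF weighted_norm_integrable[OF k assms] pointwise_dd_measurable[OF assms]])
    (use pointwise_dd_bound k in \<open>auto simp: abs_mult\<close>)

lemma f_integrable:
  assumes y: "y \<in> Linf M" and near: "AE t in M. norm (y t - x t) < \<epsilon>"
  shows "integrable M (\<lambda>t. f t (y t))"
proof (rule Bochner_Integration.integrable_bound)
  show "integrable M (\<lambda>t. \<bar>f t (x t)\<bar> + k t * \<epsilon>)" using int_fx k by simp
  show "(\<lambda>t. f t (y t)) \<in> borel_measurable M"
    using k(1) x y near by (intro superposition_measurable[OF f _ lip eps]) (auto simp: Linf_def)
  show "AE t in M. norm (f t (y t)) \<le> norm (\<bar>f t (x t)\<bar> + k t * \<epsilon>)"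
    using near
  proof eventually_elim
    case (elim t)
    have "\<bar>f t (y t) - f t (x t)\<bar> \<le> k t * norm (y t - x t)"
      using elim eps by (intro lip) (auto simp: dist_norm norm_minus_commute)
    also have "\<dots> \<le> k t * \<epsilon>" using elim k by (intro mult_left_mono) auto
    finally show ?case by auto
  qed
qed

lemma Linf_clarke_dd_sequence:
  assumes c: "ereal c < Linf_clarke_dd M G x v" and \<delta>: "\<And>n. 0 < \<delta> n"
  obtains y s where "\<And>n::nat. y n \<in> Linf M" "\<And>n. Linf_norm M (\<lambda>t. y n t - x t) < \<delta> n"
    "\<And>n. 0 < s n" "\<And>n. s n < \<delta> n" "\<And>n. c < (G (\<lambda>t. y n t + s n *\<^sub>R v t) - G (y n)) / s n"
proof -
  have "\<exists>p. fst p \<in> Linf M \<and> Linf_norm M (\<lambda>t. fst p t - x t) < \<delta> n \<and> 0 < snd p \<and> snd p < \<delta> n \<and>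
    c < (G (\<lambda>t. fst p t + snd p *\<^sub>R v t) - G (fst p)) / snd p" for n
  proof (rule ccontr)
    assume neg: "\<not> ?thesis"
    have "\<forall>\<^sub>F p in Linf_nhds M x \<times>\<^sub>F at_right (0::real).
        (\<lambda>(y, s). ereal ((G (\<lambda>t. y t + s *\<^sub>R v t) - G y) / s)) p \<le> ereal c"
      using Linf_filter_eventually[OF \<delta>[of n], of M x]
    proof eventually_elim
      case (elim p)
      then have "\<not> c < (G (\<lambda>t. fst p t + snd p *\<^sub>R v t) - G (fst p)) / snd p" using neg by blast
      then show ?case by (simp add: case_prod_beta')
    qed
    then have "Linf_clarke_dd M G x v \<le> ereal c"
      unfolding Linf_clarke_dd_def by (rule Limsup_bounded)
    then show False using c by simp
  qed
  then have "\<exists>p. \<forall>n. fst (p n) \<in> Linf M \<and> Linf_norm M (\<lambda>t. fst (p n) t - x t) < \<delta> n \<and>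
    0 < snd (p n) \<and> snd (p n) < \<delta> n \<and>
    c < (G (\<lambda>t. fst (p n) t + snd (p n) *\<^sub>R v t) - G (fst (p n))) / snd (p n)"
    by (intro choice allI)
  then obtain p where p: "\<And>n. fst (p n) \<in> Linf M" "\<And>n. Linf_norm M (\<lambda>t. fst (p n) t - x t) < \<delta> n"
    "\<And>n. 0 < snd (p n)" "\<And>n. snd (p n) < \<delta> n"
    "\<And>n. c < (G (\<lambda>t. fst (p n) t + snd (p n) *\<^sub>R v t) - G (fst (p n))) / snd (p n)"
    by blast
  show thesis by (rule that[of "\<lambda>n. fst (p n)" "\<lambda>n. snd (p n)"]) (fact p)+
qed

text \<open>The reverse Fatou argument. Only the positive part \<open>d n\<close> of the difference between the quotients and
  the pointwise Clarke derivative is controlled in the limit, and it suffices: the integral of \<open>q n\<close>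
  is at most that of the Clarke derivative plus that of \<open>d n\<close>.\<close>

lemma clarke_dd_integral_le:
  assumes v: "v \<in> Linf M"
  shows "Linf_clarke_dd M (integral_functional M f) x v \<le> ereal (\<integral>t. pointwise_dd t (v t) \<partial>M)"
proof (rule ccontr)
  assume "\<not> ?thesis"
  then obtain c where c: "(\<integral>t. pointwise_dd t (v t) \<partial>M) < c" "ereal c < Linf_clarke_dd M (integral_functional M f) x v"
    by (metis ereal_dense2 ereal_less_eq(3) less_ereal.simps(1) not_le)
  obtain C0 where C0: "AE t in M. norm (v t) \<le> C0" using v by (auto simp: Linf_def)
  define C where "C = max C0 0"
  have C: "AE t in M. norm (v t) \<le> C" "0 \<le> C"
    using C0 by (auto simp: C_def elim: eventually_mono)
  \<comment> \<open>With tolerances below \<open>a\<close>, both \<open>y n\<close> and \<open>y n + s n *\<^sub>R v\<close> stay within \<open>\<epsilon> / 2\<close> of \<open>x\<close>, where the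
    Lipschitz bound applies.\<close>
  define a where "a = \<epsilon> / (2 * (1 + C))"
  have a: "0 < a" "a * (1 + C) = \<epsilon> / 2" using eps C(2) by (auto simp: a_def field_simps)
  define \<delta> where "\<delta> n = a / real (Suc n)" for n
  have \<delta>: "0 < \<delta> n" "\<delta> n \<le> a" for n using a by (auto simp: \<delta>_def divide_simps)
  have \<delta>_lim: "\<delta> \<longlonglongrightarrow> 0"
    unfolding \<delta>_def using LIMSEQ_Suc[OF lim_const_over_n[of a]] by simp
  obtain y s where y: "\<And>n::nat. y n \<in> Linf M" "\<And>n. Linf_norm M (\<lambda>t. y n t - x t) < \<delta> n"
    and s: "\<And>n. 0 < s n" "\<And>n. s n < \<delta> n"
    and ys: "\<And>n. c < (integral_functional M f (\<lambda>t. y n t + s n *\<^sub>R v t) - integral_functional M f (y n)) / s n"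
    by (rule Linf_clarke_dd_sequence[OF c(2), of \<delta>, OF \<delta>(1)]) blast
  have "norm (s n) \<le> \<delta> n" for n using s[of n] by simp
  then have s_lim: "s \<longlonglongrightarrow> 0"
    by (rule Lim_null_comparison[OF always_eventually[OF allI] \<delta>_lim])
  have "AE t in M. \<forall>n. norm (y n t - x t) \<le> Linf_norm M (\<lambda>t. y n t - x t)"
    unfolding AE_all_countable by (intro allI Linf_norm_AE Linf_diff y x)
  then have near: "AE t in M. \<forall>n. norm (y n t - x t) < \<delta> n"
    by eventually_elim (use y(2) le_less_trans in blast)
  have both: "AE t in M. (\<forall>n. norm (y n t - x t) < \<delta> n) \<and> (\<forall>n. norm (y n t + s n *\<^sub>R v t - x t) < \<epsilon>)
    \<and> (\<forall>n. norm (y n t - x t) < \<epsilon>) \<and> norm (v t) \<le> C"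
    using near C(1)
  proof eventually_elim
    case (elim t)
    have "norm (y n t - x t) < \<epsilon>" "norm (y n t + s n *\<^sub>R v t - x t) < \<epsilon>" for n
    proof -
      have 1: "norm (y n t - x t) < a" using elim(1) \<delta>(2)[of n] by (meson less_le_trans)
      have aC: "a + a * C = \<epsilon> / 2" using a(2) by (simp add: algebra_simps)
      have "0 \<le> a * C" using a C by simp
      then show "norm (y n t - x t) < \<epsilon>" using 1 aC eps by linarith
      have "norm (s n *\<^sub>R v t) \<le> a * C"
        using s[of n] \<delta>(2)[of n] elim(2) by (auto intro!: mult_mono)
      then have "norm ((y n t - x t) + s n *\<^sub>R v t) < \<epsilon>"
        using norm_triangle_ineq[of "y n t - x t" "s n *\<^sub>R v t"] 1 aC eps by linarith
      then show "norm (y n t + s n *\<^sub>R v t - x t) < \<epsilon>" by (simp add: algebra_simps)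
    qed
    then show ?case using elim by blast
  qed
  define q where "q n t = (f t (y n t + s n *\<^sub>R v t) - f t (y n t)) / s n" for n t
  have int1: "integrable M (\<lambda>t. f t (y n t + s n *\<^sub>R v t))" for n
    using both by (intro f_integrable Linf_add Linf_scaleR y v) (auto elim: eventually_mono)
  have int2: "integrable M (\<lambda>t. f t (y n t))" for n
    using both by (intro f_integrable y) (auto elim: eventually_mono)
  have q_int: "integrable M (q n)" for n
    unfolding q_def by (intro integrable_divide_zero Bochner_Integration.integrable_diff int1 int2)
  have q_c: "c < (\<integral>t. q n t \<partial>M)" for n
    using ys[of n] int1 int2 by (simp add: q_def integral_functional_def)
  have q_bound: "AE t in M. \<forall>n. \<bar>q n t\<bar> \<le> k t * C"
    using both
  proof eventually_elim
    case (elim t)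
    have "\<bar>q n t\<bar> \<le> k t * C" for n
    proof -
      have "\<bar>f t (y n t + s n *\<^sub>R v t) - f t (y n t)\<bar> \<le> k t * norm ((y n t + s n *\<^sub>R v t) - y n t)"
        using elim by (intro lip) (auto simp: dist_norm norm_minus_commute intro: less_imp_le)
      also have "\<dots> = s n * (k t * norm (v t))" using s[of n] by simp
      also have "\<dots> \<le> s n * (k t * C)"
        using elim s[of n] k(2)[of t] by (intro mult_left_mono) auto
      finally show ?thesis using s(1)[of n] by (simp add: q_def field_simps)
    qed
    then show ?case by blast
  qed
  define d where "d n t = max 0 (q n t - pointwise_dd t (v t))" for n t
  have d_meas: "d n \<in> borel_measurable M" for n
    unfolding d_def using q_int pointwise_dd_measurable[OF v] by (intro borel_measurable_max borel_measurable_diff) auto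
  have d_bound: "AE t in M. norm (d n t) \<le> 2 * (k t * C)" for n
    using q_bound both
  proof eventually_elim
    case (elim t)
    have "k t * norm (v t) \<le> k t * C" using elim k by (intro mult_left_mono) auto
    then have "\<bar>pointwise_dd t (v t)\<bar> \<le> k t * C" using pointwise_dd_bound[of t "v t"] by linarith
    moreover have "\<bar>q n t\<bar> \<le> k t * C" using elim by blast
    ultimately show ?case by (auto simp: d_def abs_le_iff)
  qed
  have bnd_int: "integrable M (\<lambda>t. 2 * (k t * C))" using k by simp
  have d_int: "integrable M (d n)" for n
    by (rule Bochner_Integration.integrable_bound[OF bnd_int d_meas])
      (use d_bound[of n] k C in \<open>auto elim: eventually_mono\<close>)
  have d_lim: "AE t in M. (\<lambda>n. d n t) \<longlonglongrightarrow> 0"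
    using both
  proof eventually_elim
    case (elim t)
    have "norm (y n t - x t) \<le> \<delta> n" for n using elim less_imp_le by blast
    then have "(\<lambda>n. y n t - x t) \<longlonglongrightarrow> 0"
      by (rule Lim_null_comparison[OF always_eventually[OF allI] \<delta>_lim])
    then have y_lim: "(\<lambda>n. y n t) \<longlonglongrightarrow> x t" by (rule LIM_zero_cancel)
    show ?case
    proof (rule LIMSEQ_I)
      fix r :: real assume r: "0 < r"
      have "\<forall>\<^sub>F n in sequentially. q n t < pointwise_dd t (v t) + r"
        unfolding q_def using r
        by (intro clarke_dd_sequence[OF eps lip y_lim s_lim s(1)]) (auto simp: pointwise_dd_def)
      then obtain N where "\<forall>n\<ge>N. q n t < pointwise_dd t (v t) + r" by (auto simp: eventually_sequentially)
      then have "norm (d n t - 0) < r" if "n \<ge> N" for n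
        using that r by (auto simp: d_def max_def)
      then show "\<exists>N. \<forall>n\<ge>N. norm (d n t - 0) < r" by blast
    qed
  qed
  have "(\<lambda>n. \<integral>t. d n t \<partial>M) \<longlonglongrightarrow> (\<integral>t. 0 \<partial>M)"
    by (rule integral_dominated_convergence[OF _ d_meas bnd_int d_lim d_bound]) simp
  then have "(\<lambda>n. (\<integral>t. pointwise_dd t (v t) \<partial>M) + (\<integral>t. d n t \<partial>M)) \<longlonglongrightarrow> (\<integral>t. pointwise_dd t (v t) \<partial>M) + 0"
    by (intro tendsto_intros) simp
  moreover have "c \<le> (\<integral>t. pointwise_dd t (v t) \<partial>M) + (\<integral>t. d n t \<partial>M)" for n
  proof -
    have "(\<integral>t. q n t \<partial>M) \<le> (\<integral>t. pointwise_dd t (v t) + d n t \<partial>M)"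
      by (intro integral_mono q_int Bochner_Integration.integrable_add pointwise_dd_integrable v d_int) (auto simp: d_def)
    also have "\<dots> = (\<integral>t. pointwise_dd t (v t) \<partial>M) + (\<integral>t. d n t \<partial>M)"
      by (intro Bochner_Integration.integral_add pointwise_dd_integrable v d_int)
    finally show ?thesis using q_c[of n] by linarith
  qed
  ultimately have "c \<le> (\<integral>t. pointwise_dd t (v t) \<partial>M) + 0"
    by (intro LIMSEQ_le_const[of "\<lambda>n. (\<integral>t. pointwise_dd t (v t) \<partial>M) + (\<integral>t. d n t \<partial>M)"]) auto
  then show False using c(1) by simp
qed

end

section \<open>Integral representation of functionals dominated by a weighted norm\<close>

lemma simple_function_indicator_sum:
  fixes y :: "'t \<Rightarrow> 'y::real_vector"
  assumes "simple_function M y" "t \<in> space M"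
  shows "(\<Sum>c\<in>y ` space M. indicator (y -` {c} \<inter> space M) t *\<^sub>R c) = y t"
proof -
  have "(\<Sum>c\<in>y ` space M. indicator (y -` {c} \<inter> space M) t *\<^sub>R c)
    = (\<Sum>c\<in>y ` space M. if c = y t then y t else 0)"
    using assms(2) by (intro sum.cong) (auto simp: indicator_def)
  then show ?thesis using simple_functionD(1)[OF assms(1)] assms(2) by simp
qed

text \<open>Simple functions need not be dense in the supremum norm, but they are dense with respect to the
  weighted norm \<open>\<integral> k t * norm (y t)\<close>, by which the functional is assumed to be bounded.\<close>

lemma (in complete_measure) Linf_functional_eq_zero:
  fixes \<Psi> :: "('a \<Rightarrow> 'x::real_normed_vector) \<Rightarrow> real"
  assumes univ: "space M = UNIV" and k: "integrable M k" "\<And>t. 0 \<le> k t"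
    and add: "\<And>y z. y \<in> Linf M \<Longrightarrow> z \<in> Linf M \<Longrightarrow> \<Psi> (\<lambda>t. y t + z t) = \<Psi> y + \<Psi> z"
    and bound: "\<And>y. y \<in> Linf M \<Longrightarrow> \<bar>\<Psi> y\<bar> \<le> K * (\<integral>t. k t * norm (y t) \<partial>M)"
    and ind: "\<And>A u. A \<in> sets M \<Longrightarrow> \<Psi> (\<lambda>t. indicator A t *\<^sub>R u) = 0"
    and v: "v \<in> Linf M"
  shows "\<Psi> v = 0"
proof -
  have simple: "\<Psi> y = 0" if y: "simple_function M y" for y
  proof -
    have Am: "y -` {c} \<in> sets M" for c
      using simple_functionD(2)[OF y, of "{c}"] univ by simp
    have "(\<lambda>t. \<Sum>c\<in>S. indicator (y -` {c}) t *\<^sub>R c) \<in> Linf M \<and>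
      \<Psi> (\<lambda>t. \<Sum>c\<in>S. indicator (y -` {c}) t *\<^sub>R c) = 0" if "finite S" for S
      using that
    proof (induction S)
      case empty
      show ?case using Linf_indicator[of "{}" M 0] ind[of "{}" 0] by simp
    next
      case (insert a S)
      let ?G = "\<lambda>S t. \<Sum>c\<in>S. indicator (y -` {c}) t *\<^sub>R c"
      have eq: "?G (insert a S) = (\<lambda>t. indicator (y -` {a}) t *\<^sub>R a + ?G S t)"
        using insert.hyps by (intro ext sum.insert)
      have a: "(\<lambda>t. indicator (y -` {a}) t *\<^sub>R a) \<in> Linf M" by (rule Linf_indicator[OF Am])
      have S: "?G S \<in> Linf M" "\<Psi> (?G S) = 0" using insert.IH by blast+
      have "\<Psi> (\<lambda>t. indicator (y -` {a}) t *\<^sub>R a + ?G S t) = 0"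
        unfolding add[OF a S(1)] S(2) ind[OF Am] by (rule add_0_left)
      then show ?case unfolding eq by (rule conjI[OF Linf_add[OF a S(1)]])
    qed
    from this[OF simple_functionD(1)[OF y]]
    have "\<Psi> (\<lambda>t. \<Sum>c\<in>y ` space M. indicator (y -` {c}) t *\<^sub>R c) = 0" ..
    moreover have "(\<lambda>t. \<Sum>c\<in>y ` space M. indicator (y -` {c}) t *\<^sub>R c) = y"
    proof
      fix t
      show "(\<Sum>c\<in>y ` space M. indicator (y -` {c}) t *\<^sub>R c) = y t"
        using simple_function_indicator_sum[OF y, of t] unfolding univ Int_UNIV_right by (simp only: UNIV_I)
    qed
    ultimately show ?thesis by simp
  qed
  obtain C where C: "AE t in M. norm (v t) \<le> C" and vm: "strongly_measurable M v"
    using v by (auto simp: Linf_def)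
  obtain s where s: "\<forall>i::nat. simple_function M (s i)" "AE t in M. (\<lambda>i. s i t) \<longlonglongrightarrow> v t"
    using vm unfolding strongly_measurable_def by (elim exE conjE)
  \<comment> \<open>Truncating just above the essential bound of \<open>v\<close> keeps the approximants dominated and does not
    change them eventually.\<close>
  define C' where "C' = max C 0 + 1"
  define z where "z i t = (if norm (s i t) \<le> C' then s i t else 0)" for i t
  have zs: "simple_function M (z i)" for i
    using s(1) unfolding z_def by (intro simple_function_compose1[of M "s i" "\<lambda>a. if norm a \<le> C' then a else 0"]) simp
  have zL: "z i \<in> Linf M" for i by (intro Linf_simple zs)
  have zlim: "AE t in M. (\<lambda>i. k t * norm (v t - z i t)) \<longlonglongrightarrow> 0"
    using s(2) C
  proof eventually_elim
    case (elim t)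
    have "(\<lambda>i. norm (s i t)) \<longlonglongrightarrow> norm (v t)" by (intro tendsto_norm elim)
    moreover have "norm (v t) < C'" using elim(2) by (simp add: C'_def)
    ultimately have "\<forall>\<^sub>F i in sequentially. norm (s i t) < C'" by (rule order_tendstoD)
    then have "\<forall>\<^sub>F i in sequentially. s i t = z i t"
      by eventually_elim (simp add: z_def)
    then have "(\<lambda>i. z i t) \<longlonglongrightarrow> v t" by (rule Lim_transform_eventually[OF elim(1)])
    then have "(\<lambda>i. k t * norm (v t - z i t)) \<longlonglongrightarrow> k t * norm (v t - v t)" by (intro tendsto_intros)
    then show ?case by simp
  qed
  have "(\<lambda>i. \<integral>t. k t * norm (v t - z i t) \<partial>M) \<longlonglongrightarrow> (\<integral>t. 0 \<partial>M)"
  proof (rule integral_dominated_convergence[OF _ _ _ zlim])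
    show "(\<lambda>t. k t * norm (v t - z i t)) \<in> borel_measurable M" for i
      using k(1) by (intro borel_measurable_times strongly_measurable_norm_diff vm strongly_measurable_simple zs) simp
    show "integrable M (\<lambda>t. k t * (2 * C'))" using k by simp
    show "AE t in M. norm (k t * norm (v t - z i t)) \<le> k t * (2 * C')" for i
      using C
    proof eventually_elim
      case (elim t)
      have "norm (z i t) \<le> C'" by (simp add: z_def C'_def)
      then have "norm (v t - z i t) \<le> 2 * C'"
        using norm_triangle_ineq4[of "v t" "z i t"] elim by (simp add: C'_def)
      then show ?case using k(2)[of t] by (auto simp: abs_mult intro!: mult_left_mono)
    qed
  qed simp
  then have "(\<lambda>i. K * (\<integral>t. k t * norm (v t - z i t) \<partial>M)) \<longlonglongrightarrow> K * 0"
    by (intro tendsto_intros) simp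
  moreover have "\<bar>\<Psi> v\<bar> \<le> K * (\<integral>t. k t * norm (v t - z i t) \<partial>M)" for i
  proof -
    have "\<Psi> (\<lambda>t. (v t - z i t) + z i t) = \<Psi> (\<lambda>t. v t - z i t) + \<Psi> (z i)"
      by (intro add Linf_diff v zL)
    then have "\<Psi> v = \<Psi> (\<lambda>t. v t - z i t)" by (simp add: simple[OF zs])
    then show ?thesis using bound[OF Linf_diff[OF v zL]] by simp
  qed
  ultimately have "\<bar>\<Psi> v\<bar> \<le> K * 0"
    by (intro LIMSEQ_le_const[of "\<lambda>i. K * (\<integral>t. k t * norm (v t - z i t) \<partial>M)"]) auto
  then show ?thesis by simp
qed

text \<open>The indicator functions turn \<open>\<phi>\<close> into a vector measure \<open>\<nu>\<close> dominated by the measure \<open>N\<close> with density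
  \<open>k\<close>. The density of \<open>\<nu>\<close> with respect to \<open>N\<close>, multiplied by \<open>k\<close>, represents \<open>\<phi>\<close> on indicator
  functions, and therefore everywhere.\<close>

lemma (in complete_measure) Linf_functional_density:
  fixes \<phi> :: "('a \<Rightarrow> 'x::banach) \<Rightarrow> real"
  assumes asp: "asplund_space TYPE('x)" and univ: "space M = UNIV"
    and k: "integrable M k" "\<And>t. 0 \<le> k t"
    and add: "\<And>y z. y \<in> Linf M \<Longrightarrow> z \<in> Linf M \<Longrightarrow> \<phi> (\<lambda>t. y t + z t) = \<phi> y + \<phi> z"
    and scale: "\<And>c y. y \<in> Linf M \<Longrightarrow> \<phi> (\<lambda>t. c *\<^sub>R y t) = c * \<phi> y"
    and bound: "\<And>y. y \<in> Linf M \<Longrightarrow> \<bar>\<phi> y\<bar> \<le> (\<integral>t. k t * norm (y t) \<partial>M)"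
  obtains \<xi> where "\<xi> \<in> Lone M" "\<And>y. y \<in> Linf M \<Longrightarrow> integrable M (\<lambda>t. blinfun_apply (\<xi> t) (y t))"
    "\<And>y. y \<in> Linf M \<Longrightarrow> \<phi> y = (\<integral>t. blinfun_apply (\<xi> t) (y t) \<partial>M)"
proof -
  have km: "k \<in> borel_measurable M" using k by simp
  define N where "N = density M (\<lambda>t. ennreal (k t))"
  have sN[simp]: "sets N = sets M" "space N = space M" by (simp_all add: N_def)
  have emN: "emeasure N A = ennreal (\<integral>t. k t * indicator A t \<partial>M)" if "A \<in> sets M" for A
  proof -
    have "emeasure N A = (\<integral>\<^sup>+t. ennreal (k t * indicator A t) \<partial>M)"
      using that km by (auto simp: N_def emeasure_density intro!: nn_integral_cong split: split_indicator)
    also have "\<dots> = ennreal (\<integral>t. k t * indicator A t \<partial>M)"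
      using that k by (intro nn_integral_eq_integral integrable_real_mult_indicator) auto
    finally show ?thesis .
  qed
  have mN: "measure N A = (\<integral>t. k t * indicator A t \<partial>M)" if "A \<in> sets M" for A
    using emN[OF that] k by (simp add: measure_def)
  have finN: "finite_measure N"
    using emN[of "space M"] by (intro finite_measureI) simp
  define \<nu> where "\<nu> A = Blinfun (\<lambda>u. \<phi> (\<lambda>t. indicator A t *\<^sub>R u))" for A
  have ind_bound: "\<bar>\<phi> (\<lambda>t. indicator A t *\<^sub>R u)\<bar> \<le> measure N A * norm u" if "A \<in> sets M" for A u
  proof -
    have "\<bar>\<phi> (\<lambda>t. indicator A t *\<^sub>R u)\<bar> \<le> (\<integral>t. k t * norm (indicator A t *\<^sub>R u) \<partial>M)"
      by (intro bound Linf_indicator that)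
    also have "\<dots> = (\<integral>t. (k t * indicator A t) * norm u \<partial>M)" by (simp add: mult.assoc)
    also have "\<dots> = measure N A * norm u" using mN[OF that] by simp
    finally show ?thesis .
  qed
  have \<nu>: "blinfun_apply (\<nu> A) u = \<phi> (\<lambda>t. indicator A t *\<^sub>R u)" if A: "A \<in> sets M" for A u
  proof -
    have "bounded_linear (\<lambda>u. \<phi> (\<lambda>t. indicator A t *\<^sub>R u))"
    proof (rule bounded_linear_intro)
      show "\<phi> (\<lambda>t. indicator A t *\<^sub>R (u + w)) = \<phi> (\<lambda>t. indicator A t *\<^sub>R u) + \<phi> (\<lambda>t. indicator A t *\<^sub>R w)" for u w
        using add[OF Linf_indicator[OF A] Linf_indicator[OF A], of u w] by (simp add: scaleR_add_right)
      show "\<phi> (\<lambda>t. indicator A t *\<^sub>R (c *\<^sub>R u)) = c *\<^sub>R \<phi> (\<lambda>t. indicator A t *\<^sub>R u)" for c u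
        using scale[OF Linf_indicator[OF A], of c u] by (simp add: mult.commute)
      show "norm (\<phi> (\<lambda>t. indicator A t *\<^sub>R u)) \<le> norm u * measure N A" for u
        using ind_bound[OF A, of u] by (simp add: mult.commute)
    qed
    then show ?thesis by (simp add: \<nu>_def bounded_linear_Blinfun_apply)
  qed
  have \<nu>_add: "\<nu> (A \<union> B) = \<nu> A + \<nu> B" if "A \<in> sets N" "B \<in> sets N" "A \<inter> B = {}" for A B
  proof (rule blinfun_eqI)
    fix u :: 'x
    have "(\<lambda>t. indicator (A \<union> B) t *\<^sub>R u) = (\<lambda>t. indicator A t *\<^sub>R u + indicator B t *\<^sub>R u)"
      using that(3) by (auto simp: indicator_def fun_eq_iff)
    then show "blinfun_apply (\<nu> (A \<union> B)) u = blinfun_apply (\<nu> A + \<nu> B) u"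
      using that add[OF Linf_indicator Linf_indicator, of A B u u] by (simp add: \<nu> blinfun.add_left)
  qed
  have \<nu>_bound: "norm (\<nu> A) \<le> measure N A" if "A \<in> sets N" for A
    using that ind_bound by (intro norm_blinfun_bound) (simp_all add: \<nu>)
  obtain s \<eta> where s: "\<And>i::nat. simple_function N (s i)"
    "\<And>t. t \<in> space N \<Longrightarrow> (\<lambda>i. s i t) \<longlonglongrightarrow> \<eta> t" and \<eta>2: "\<And>t. t \<in> space N \<Longrightarrow> norm (\<eta> t) \<le> 2"
    and \<eta>: "\<And>A u. A \<in> sets N \<Longrightarrow> blinfun_apply (\<nu> A) u = (\<integral>t. indicator A t * blinfun_apply (\<eta> t) u \<partial>N)"
    by (rule finite_measure.asplund_dual_Radon_Nikodym[OF finN asp \<nu>_add \<nu>_bound]) blast+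
  have "simple_function M (s i)" for i
    using s(1)[of i] by (simp add: simple_function_def)
  then have \<eta>m: "strongly_measurable M \<eta>"
    unfolding strongly_measurable_def using s(2) by (intro exI[of _ s]) auto
  define \<xi> where "\<xi> t = k t *\<^sub>R \<eta> t" for t
  have \<xi>m: "strongly_measurable M \<xi>"
    unfolding \<xi>_def by (intro strongly_measurable_compose2[of M k \<eta> "(*\<^sub>R)"] tendsto_scaleR
        strongly_measurable_real km \<eta>m)
  have \<xi>2: "norm (\<xi> t) \<le> 2 * k t" for t
    using \<eta>2[of t] k(2)[of t] univ mult_left_mono[of "norm (\<eta> t)" 2 "k t"] by (simp add: \<xi>_def)
  have "integrable M (\<lambda>t. norm (\<xi> t))"
    by (rule Bochner_Integration.integrable_bound[of M "\<lambda>t. 2 * k t"])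
      (use k \<xi>2 in \<open>auto intro: strongly_measurable_norm \<xi>m order_trans abs_ge_self\<close>)
  then have Lone: "\<xi> \<in> Lone M" using \<xi>m by (simp add: Lone_def)
  note knorm = weighted_norm_integrable[OF k]
  have pair_bound: "\<bar>blinfun_apply (\<xi> t) u\<bar> \<le> 2 * (k t * norm u)" for t u
    using norm_blinfun[of "\<xi> t" u] mult_right_mono[OF \<xi>2[of t] norm_ge_zero[of u]] by simp
  have pair_int: "integrable M (\<lambda>t. blinfun_apply (\<xi> t) (y t))" if y: "y \<in> Linf M" for y
  proof (rule Bochner_Integration.integrable_bound)
    show "integrable M (\<lambda>t. 2 * (k t * norm (y t)))" using knorm[OF y] by simp
    show "(\<lambda>t. blinfun_apply (\<xi> t) (y t)) \<in> borel_measurable M"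
      using y by (intro strongly_measurable_imp_borel strongly_measurable_compose2[of M \<xi> y blinfun_apply] \<xi>m blinfun.tendsto)
        (auto simp: Linf_def)
    show "AE t in M. norm (blinfun_apply (\<xi> t) (y t)) \<le> norm (2 * (k t * norm (y t)))"
      using pair_bound k by (auto intro: order_trans abs_ge_self)
  qed
  define \<Psi> where "\<Psi> y = \<phi> y - (\<integral>t. blinfun_apply (\<xi> t) (y t) \<partial>M)" for y
  have "\<Psi> y = 0" if "y \<in> Linf M" for y
  proof (rule Linf_functional_eq_zero[of k \<Psi> 3, OF univ k _ _ _ that])
    show "\<Psi> (\<lambda>t. y t + z t) = \<Psi> y + \<Psi> z" if "y \<in> Linf M" "z \<in> Linf M" for y z
      using that by (simp add: \<Psi>_def add blinfun.add_right pair_int)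
    show "\<bar>\<Psi> y\<bar> \<le> 3 * (\<integral>t. k t * norm (y t) \<partial>M)" if y: "y \<in> Linf M" for y
    proof -
      have "\<bar>\<integral>t. blinfun_apply (\<xi> t) (y t) \<partial>M\<bar> \<le> (\<integral>t. \<bar>blinfun_apply (\<xi> t) (y t)\<bar> \<partial>M)"
        using integral_norm_bound[of M "\<lambda>t. blinfun_apply (\<xi> t) (y t)"] by simp
      also have "\<dots> \<le> (\<integral>t. 2 * (k t * norm (y t)) \<partial>M)"
        using pair_int[OF y] knorm[OF y] by (intro integral_mono pair_bound) auto
      finally show ?thesis using bound[OF y] by (simp add: \<Psi>_def)
    qed
    show "\<Psi> (\<lambda>t. indicator A t *\<^sub>R u) = 0" if A: "A \<in> sets M" for A u
    proof -
      have \<eta>um: "(\<lambda>t. indicator A t * blinfun_apply (\<eta> t) u) \<in> borel_measurable M"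
        by (intro borel_measurable_times borel_measurable_indicator A strongly_measurable_imp_borel
            strongly_measurable_compose2[of M \<eta> "\<lambda>_. u" blinfun_apply] \<eta>m strongly_measurable_const blinfun.tendsto)
      have "\<phi> (\<lambda>t. indicator A t *\<^sub>R u) = (\<integral>t. indicator A t * blinfun_apply (\<eta> t) u \<partial>N)"
        using \<eta>[of A u] A by (simp add: \<nu>)
      also have "\<dots> = (\<integral>t. k t *\<^sub>R (indicator A t * blinfun_apply (\<eta> t) u) \<partial>M)"
        unfolding N_def using \<eta>um km k by (intro integral_density) auto
      also have "\<dots> = (\<integral>t. blinfun_apply (\<xi> t) (indicator A t *\<^sub>R u) \<partial>M)"
        by (simp add: \<xi>_def blinfun.scaleR_right blinfun.scaleR_left mult.left_commute)
      finally show ?thesis by (simp add: \<Psi>_def)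
    qed
  qed
  then have rep: "\<phi> y = (\<integral>t. blinfun_apply (\<xi> t) (y t) \<partial>M)" if "y \<in> Linf M" for y
    using that by (simp add: \<Psi>_def)
  show thesis by (rule that[OF Lone pair_int rep])
qed

section \<open>Subgradients of the integral functional\<close>

context clarke_integral_setting
begin

text \<open>Testing \<open>\<phi>\<close> with \<open>u\<close> on the set where \<open>\<xi> t u\<close> exceeds the pointwise Clarke derivative shows that this
  set is null.\<close>

lemma clarke_subdiff_integral:
  assumes asp: "asplund_space TYPE('x)" and \<phi>: "\<phi> \<in> Linf_clarke_subdiff M (integral_functional M f) x"
  obtains \<xi> where "\<phi> = Lone_functional M \<xi>" "\<xi> \<in> Lone M" "AE t in M. \<xi> t \<in> clarke_subdiff (f t) (x t)"
proof -
  have ext: "\<phi> \<in> extensional (Linf M)"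
    and add: "\<And>y z. y \<in> Linf M \<Longrightarrow> z \<in> Linf M \<Longrightarrow> \<phi> (\<lambda>t. y t + z t) = \<phi> y + \<phi> z"
    and scale: "\<And>c y. y \<in> Linf M \<Longrightarrow> \<phi> (\<lambda>t. c *\<^sub>R y t) = c * \<phi> y"
    and sub: "\<And>v. v \<in> Linf M \<Longrightarrow> ereal (\<phi> v) \<le> Linf_clarke_dd M (integral_functional M f) x v"
    using \<phi> by (auto simp: Linf_clarke_subdiff_def Linf_dual_def)
  have le_h: "\<phi> v \<le> (\<integral>t. pointwise_dd t (v t) \<partial>M)" if "v \<in> Linf M" for v
    using order_trans[OF sub[OF that] clarke_dd_integral_le[OF that]] by simp
  have le_k: "\<phi> v \<le> (\<integral>t. k t * norm (v t) \<partial>M)" if v: "v \<in> Linf M" for v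
  proof -
    have "(\<integral>t. pointwise_dd t (v t) \<partial>M) \<le> (\<integral>t. k t * norm (v t) \<partial>M)"
      using pointwise_dd_bound abs_le_D1 by (intro integral_mono pointwise_dd_integrable weighted_norm_integrable k v) blast
    with le_h[OF v] show ?thesis by linarith
  qed
  have bound: "\<bar>\<phi> v\<bar> \<le> (\<integral>t. k t * norm (v t) \<partial>M)" if v: "v \<in> Linf M" for v
    using le_k[OF v] le_k[OF Linf_scaleR[OF v, of "-1"]] scale[OF v, of "-1"] by (simp add: abs_le_iff)
  obtain \<xi> where \<xi>: "\<xi> \<in> Lone M" "\<And>y. y \<in> Linf M \<Longrightarrow> integrable M (\<lambda>t. blinfun_apply (\<xi> t) (y t))"
    "\<And>y. y \<in> Linf M \<Longrightarrow> \<phi> y = (\<integral>t. blinfun_apply (\<xi> t) (y t) \<partial>M)"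
    by (rule Linf_functional_density[of k \<phi>, OF asp space_UNIV k add scale bound]) blast+
  have \<xi>m: "strongly_measurable M \<xi>" using \<xi>(1) by (simp add: Lone_def)
  have dir: "AE t in M. blinfun_apply (\<xi> t) u \<le> pointwise_dd t u" for u
  proof -
    have um: "(\<lambda>t. blinfun_apply (\<xi> t) u) \<in> borel_measurable M"
      by (intro strongly_measurable_imp_borel
            strongly_measurable_compose2[of M \<xi> "\<lambda>_. u" blinfun_apply] \<xi>m strongly_measurable_const blinfun.tendsto)
    have hm: "(\<lambda>t. pointwise_dd t u) \<in> borel_measurable M"
      using pointwise_dd_measurable[of "\<lambda>_. u"] Linf_simple[of M "\<lambda>_. u"] by simp
    define A where "A = {t \<in> space M. pointwise_dd t u < blinfun_apply (\<xi> t) u}"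
    have A: "A \<in> sets M" unfolding A_def using um hm by (intro borel_measurable_less)
    let ?v = "\<lambda>t. indicator A t *\<^sub>R u"
    have v: "?v \<in> Linf M" by (rule Linf_indicator[OF A])
    have nn: "0 \<le> blinfun_apply (\<xi> t) (?v t) - pointwise_dd t (?v t)" for t
      by (cases "t \<in> A") (auto simp: A_def pointwise_dd_zero)
    have int: "integrable M (\<lambda>t. blinfun_apply (\<xi> t) (?v t) - pointwise_dd t (?v t))"
      by (intro Bochner_Integration.integrable_diff \<xi>(2) pointwise_dd_integrable v)
    have "(\<integral>t. blinfun_apply (\<xi> t) (?v t) - pointwise_dd t (?v t) \<partial>M) \<le> 0"
      using le_h[OF v] \<xi>(3)[OF v] by (simp add: Bochner_Integration.integral_diff[OF \<xi>(2)[OF v] pointwise_dd_integrable[OF v]])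
    moreover have "0 \<le> (\<integral>t. blinfun_apply (\<xi> t) (?v t) - pointwise_dd t (?v t) \<partial>M)"
      by (intro integral_nonneg_AE AE_I2 nn)
    ultimately have "(\<integral>t. blinfun_apply (\<xi> t) (?v t) - pointwise_dd t (?v t) \<partial>M) = 0" by linarith
    then have "AE t in M. blinfun_apply (\<xi> t) (?v t) - pointwise_dd t (?v t) = 0"
      using integral_nonneg_eq_0_iff_AE[OF int] nn by simp
    then show ?thesis using AE_space
    proof eventually_elim
      case (elim t)
      then show ?case by (cases "t \<in> A") (auto simp: A_def)
    qed
  qed
  have "AE t in M. \<forall>u. blinfun_apply (\<xi> t) u \<le> pointwise_dd t u"
    using k(1) by (intro AE_all_directions[OF pointwise_dd_lusin _ pointwise_dd_lipschitz \<xi>m dir]) simp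
  then have "AE t in M. \<xi> t \<in> clarke_subdiff (f t) (x t)"
    by eventually_elim (simp add: clarke_subdiff_def dd_eq)
  moreover have "\<phi> = Lone_functional M \<xi>"
  proof (rule extensionalityI[OF ext])
    show "Lone_functional M \<xi> \<in> extensional (Linf M)" by (simp add: Lone_functional_def)
    show "\<phi> y = Lone_functional M \<xi> y" if "y \<in> Linf M" for y
      using \<xi>(3)[OF that] that by (simp add: Lone_functional_def)
  qed
  ultimately show thesis using that \<xi>(1) by blast
qed

end

theorem theorem7p2:
  fixes M :: "'t::metric_space measure"
    and f :: "'t \<Rightarrow> 'x::banach \<Rightarrow> real"
    and x :: "'t \<Rightarrow> 'x"
    and k :: "'t \<Rightarrow> real"
    and \<epsilon> :: real
  assumes "space M = UNIV"
    and "sets borel \<subseteq> sets M"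
    and "complete_measure M"
    and "sigma_finite_measure M"
    and "inner_regular M"
    and "asplund_space TYPE('x)"
    and "x \<in> Linf M"
    and "lusin_integrand M (\<lambda>t u. ereal (f t u))"
    and "integrable M k"
    and "\<And>t. 0 \<le> k t"
    and "0 < \<epsilon>"
    and "\<And>t u v. u \<in> cball (x t) \<epsilon> \<Longrightarrow> v \<in> cball (x t) \<epsilon> \<Longrightarrow> \<bar>f t u - f t v\<bar> \<le> k t * norm (u - v)"
    and I_f_finite_at_x: "integrable M (\<lambda>t. f t (x t))"
    and "lusin_integrand M (\<lambda>t. clarke_dd (f t) (x t))"
  shows "(\<forall>v\<in>Linf M.
            integrable M (\<lambda>t. real_of_ereal (clarke_dd (f t) (x t) (v t))) \<and>
            Linf_clarke_dd M (integral_functional M f) x v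
              \<le> ereal (\<integral>t. real_of_ereal (clarke_dd (f t) (x t) (v t)) \<partial>M)) \<and>
         Linf_clarke_subdiff M (integral_functional M f) x
           \<subseteq> {Lone_functional M \<xi> | \<xi>. \<xi> \<in> Lone M \<and> (AE t in M. \<xi> t \<in> clarke_subdiff (f t) (x t))}"
proof -
  interpret clarke_integral_setting M f x k \<epsilon>
    using assms
    by (auto simp: clarke_integral_setting_def clarke_integral_setting_axioms_def
        lusin_measure_space_def lusin_measure_space_axioms_def)
  show ?thesis
  proof (intro conjI ballI subsetI)
    fix v :: "'t \<Rightarrow> 'x" assume v: "v \<in> Linf M"
    show "integrable M (\<lambda>t. real_of_ereal (clarke_dd (f t) (x t) (v t)))"
      using pointwise_dd_integrable[OF v] by (simp add: pointwise_dd_def)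
    show "Linf_clarke_dd M (integral_functional M f) x v
        \<le> ereal (\<integral>t. real_of_ereal (clarke_dd (f t) (x t) (v t)) \<partial>M)"
      using clarke_dd_integral_le[OF v] by (simp add: pointwise_dd_def)
  next
    fix \<phi> assume \<phi>: "\<phi> \<in> Linf_clarke_subdiff M (integral_functional M f) x"
    obtain \<xi> where "\<phi> = Lone_functional M \<xi>" "\<xi> \<in> Lone M" "AE t in M. \<xi> t \<in> clarke_subdiff (f t) (x t)"
      by (rule clarke_subdiff_integral[OF assms(6) \<phi>])
    then show "\<phi> \<in> {Lone_functional M \<xi> | \<xi>. \<xi> \<in> Lone M \<and> (AE t in M. \<xi> t \<in> clarke_subdiff (f t) (x t))}"
      by blast
  qed
qed

end
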